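(* Let $\beta>\frac{\pi}{2}$ and let $\Omega_\beta\subset\mathbb{C}^2$ be a worm domain. Then $$S(\Omega_\beta)=\begin{cases}\dfrac{\pi}{2(\pi-\beta)} & \text{for } \frac{\pi}{2}<\beta<\pi,\\[2mm] \infty & \text{for }\pi\le\beta.\end{cases}$$
   Context: Smooth means $C^\infty$. Worm domain: for $\beta>\frac{\pi}{2}$, $$\Omega_\beta:=\left\{(z,w)\in\mathbb{C}^2:\ \left|z-e^{i\log|w|^2}\right|^2-\left(1-\phi(\log|w|^2)\right)<0\right\},$$ where $\phi:\mathbb{R}\to\mathbb{R}$ is a fixed smooth function such that: (i) $\phi\ge0$, $\phi$ is even and convex; (ii) $\phi^{-1}(0)=[-(\beta-\frac{\pi}{2}),\beta-\frac{\pi}{2}]$; (iii) there exists $a>0$ such that $\phi(x)>1$ if $x<-a$ or $x>a$; (iv) $\phi'(x)\ne0$ if $\phi(x)=1$. For a bounded domain $\Omega\subset\mathbb{C}^n$ with smooth boundary, a (global) defining function of $\Omega$ is a smooth real function $\rho$ on a neighborhood $V$ of $\overline\Omega$ with $\Omega=\{z\in V:\rho(z)<0\}$ and $d\rho\neq0$ on $\partial\Omega$. Steinness index: with $\overline\Omega^{\complement}=\mathbb{C}^n\setminus\overline\Omega$, $\widetilde\eta_\rho:=\inf\{\widetilde\eta>1: \rho^{\widetilde\eta}\text{ is strictly plurisubharmonic on }\overline\Omega^{\complement}\cap U\text{ for some neighborhood }U\text{ of }\partial\Omega\}$ (and $\widetilde\eta_\rho=\infty$ if there is no such $\widetilde\eta$);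 $S(\Omega):=\inf_\rho\widetilde\eta_\rho$ over all defining functions $\rho$ of $\Omega$. *)

theory Defs
  imports "HOL-Analysis.Analysis"
begin

(* C^n and C^infinity in the sense of iterated directional derivatives; meant for open S. *)
primrec higher_differentiable_on ::
  "'a::real_normed_vector set \<Rightarrow> ('a \<Rightarrow> 'b::real_normed_vector) \<Rightarrow> nat \<Rightarrow> bool" where
  "higher_differentiable_on S f 0 \<longleftrightarrow> continuous_on S f"
| "higher_differentiable_on S f (Suc n) \<longleftrightarrow>
     (\<forall>x\<in>S. f differentiable (at x)) \<and>
     (\<forall>v. higher_differentiable_on S (\<lambda>x. frechet_derivative f (at x) v) n)"

definition smooth_on :: "'a::real_normed_vector set \<Rightarrow> ('a \<Rightarrow> 'b::real_normed_vector) \<Rightarrow> bool" where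
  "smooth_on S f \<longleftrightarrow> (\<forall>n. higher_differentiable_on S f n)"

definition wirtinger :: "'n::finite \<Rightarrow> (complex ^ 'n \<Rightarrow> complex) \<Rightarrow> complex ^ 'n \<Rightarrow> complex" where
  "wirtinger j f z = (frechet_derivative f (at z) (axis j 1)
                      - \<i> * frechet_derivative f (at z) (axis j \<i>)) / 2"

definition wirtinger_bar :: "'n::finite \<Rightarrow> (complex ^ 'n \<Rightarrow> complex) \<Rightarrow> complex ^ 'n \<Rightarrow> complex" where
  "wirtinger_bar j f z = (frechet_derivative f (at z) (axis j 1)
                          + \<i> * frechet_derivative f (at z) (axis j \<i>)) / 2"

definition levi_form :: "(complex ^ 'n::finite \<Rightarrow> real) \<Rightarrow> complex ^ 'n \<Rightarrow> complex ^ 'n \<Rightarrow> complex" where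
  "levi_form f z t =
     (\<Sum>j\<in>UNIV. \<Sum>k\<in>UNIV.
        wirtinger j (wirtinger_bar k (\<lambda>x. complex_of_real (f x))) z * t $ j * cnj (t $ k))"

(* For a C^2 function the Levi form is Hermitian, so Re only converts its values to type real. *)
definition strictly_plurisubharmonic_on ::
  "(complex ^ 'n::finite) set \<Rightarrow> (complex ^ 'n \<Rightarrow> real) \<Rightarrow> bool" where
  "strictly_plurisubharmonic_on S f \<longleftrightarrow>
     higher_differentiable_on S f 2 \<and> (\<forall>z\<in>S. \<forall>t. t \<noteq> 0 \<longrightarrow> 0 < Re (levi_form f z t))"

(* V is the domain of rho; the values of the total function rho outside V are irrelevant. *)
definition defining_function ::
  "(complex ^ 'n::finite) set \<Rightarrow> (complex ^ 'n) set \<Rightarrow> (complex ^ 'n \<Rightarrow> real) \<Rightarrow> bool" where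
  "defining_function \<Omega> V \<rho> \<longleftrightarrow>
     open V \<and> closure \<Omega> \<subseteq> V \<and> smooth_on V \<rho> \<and>
     \<Omega> = {z \<in> V. \<rho> z < 0} \<and>
     (\<forall>z\<in>frontier \<Omega>. frechet_derivative \<rho> (at z) \<noteq> (\<lambda>v. 0))"

(* On U - closure \<Omega> \<subseteq> V one has rho >= 0, so powr is the usual real power there.
   The infimum of the empty set in ereal is infinity. *)
definition steinness_exponent ::
  "(complex ^ 'n::finite) set \<Rightarrow> (complex ^ 'n) set \<Rightarrow> (complex ^ 'n \<Rightarrow> real) \<Rightarrow> ereal" where
  "steinness_exponent \<Omega> V \<rho> =
     Inf (ereal ` {\<eta>. \<eta> > 1 \<and>
       (\<exists>U. open U \<and> frontier \<Omega> \<subseteq> U \<and> U \<subseteq> V \<and>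
            strictly_plurisubharmonic_on ((- closure \<Omega>) \<inter> U) (\<lambda>z. \<rho> z powr \<eta>))})"

definition steinness_index :: "(complex ^ 'n::finite) set \<Rightarrow> ereal" where
  "steinness_index \<Omega> = Inf {steinness_exponent \<Omega> V \<rho> | V \<rho>. defining_function \<Omega> V \<rho>}"

definition worm_profile :: "real \<Rightarrow> (real \<Rightarrow> real) \<Rightarrow> bool" where
  "worm_profile \<beta> \<phi> \<longleftrightarrow>
     smooth_on UNIV \<phi> \<and>
     (\<forall>x. 0 \<le> \<phi> x) \<and> (\<forall>x. \<phi> (- x) = \<phi> x) \<and> convex_on UNIV \<phi> \<and>
     \<phi> -` {0} = {- (\<beta> - pi / 2) .. \<beta> - pi / 2} \<and>
     (\<exists>a>0. \<forall>x. x < - a \<or> x > a \<longrightarrow> \<phi> x > 1) \<and>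
     (\<forall>x. \<phi> x = 1 \<longrightarrow> deriv \<phi> x \<noteq> 0)"

(* The worm depends on \<beta> only through \<phi>.  The condition w \<noteq> 0 is implicit in the use of log |w|^2;
   it has to be explicit here because ln 0 = 0. *)
definition worm_domain :: "(real \<Rightarrow> real) \<Rightarrow> (complex ^ 2) set" where
  "worm_domain \<phi> = {p. let z = p $ 1; w = p $ 2 in
     w \<noteq> 0 \<and>
     (cmod (z - exp (\<i> * complex_of_real (ln ((cmod w)\<^sup>2)))))\<^sup>2 - (1 - \<phi> (ln ((cmod w)\<^sup>2))) < 0}"

end

theory Submission
  imports Defs "HOL-Real_Asymp.Real_Asymp"
begin

text \<open>
  Write \<open>s = ln |w|\<^sup>2\<close>, \<open>b = \<beta> - \<pi>/2\<close> and let \<open>r\<close> be the standard defining function of the worm domain.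

  Upper bound. For \<open>\<rho> = r * exp (u s)\<close> the power \<open>\<rho>\<^sup>\<eta>\<close> is strictly plurisubharmonic outside, near the
  boundary, as soon as \<open>u'' > k (1 + u'\<^sup>2)\<close> on \<open>[-b, b]\<close> with \<open>k = \<eta> / (\<eta> - 1)\<close>: there the weight alone is enough,
  and elsewhere \<open>\<phi> > 0\<close> gives strict pseudoconvexity. Such a \<open>u\<close> exists iff \<open>k b < \<pi>/2\<close>, that is
  \<open>\<eta> > \<pi> / (2 (\<pi> - \<beta>))\<close>.

  Lower bound. Given any defining function with exponent \<open>\<eta>\<close>, pull \<open>\<rho>\<^sup>\<eta>\<close> back along the holomorphic curves
  \<open>\<zeta> \<mapsto> (- \<delta> exp (i \<mu> \<zeta>), exp (\<zeta>/2))\<close>, which lie outside the closure for \<open>|Re \<zeta>| \<le> b\<close>, and divide by \<open>\<delta>\<^sup>\<eta>\<close>.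
  For \<open>\<mu> = 1 - \<pi> / (2 b)\<close> (with \<open>b\<close> cut down to \<open>\<pi>/2\<close> if it is larger) the limit as \<open>\<delta> \<rightarrow> 0\<close> is
  \<open>exp (- \<eta> \<mu> Im \<zeta>)\<close> times a function of \<open>w\<close> that vanishes at \<open>|Re \<zeta>| = b\<close>. If \<open>\<eta> |\<mu>| < \<pi> / (2 b)\<close>, choose \<open>l\<close> between
  the two; the quotient of the limit by the strictly superharmonic function \<open>exp (- \<eta> \<mu> Im \<zeta>) cos (l Re \<zeta>)\<close> has an
  interior maximum, which contradicts the maximum principle for \<open>\<delta>\<close> small.
\<close>

subsection \<open>Calculus of smooth functions\<close>

lemma frechet_derivative_cong_open:
  assumes "open S" "x \<in> S" "\<And>y. y \<in> S \<Longrightarrow> f y = g y"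
  shows "frechet_derivative f (at x) = frechet_derivative g (at x)"
    and "f differentiable (at x) \<longleftrightarrow> g differentiable (at x)"
proof -
  have "(f has_derivative D) (at x) \<longleftrightarrow> (g has_derivative D) (at x)" for D
    using has_derivative_transform_within_open[of f D x UNIV S g]
      has_derivative_transform_within_open[of g D x UNIV S f] assms by auto
  then show "frechet_derivative f (at x) = frechet_derivative g (at x)"
    and "f differentiable (at x) \<longleftrightarrow> g differentiable (at x)"
    by (simp_all add: frechet_derivative_def differentiable_def)
qed

text \<open>Product, chain and sum rules give formulas for a derivative that hold only at points of
  \<open>S\<close>. Openness makes the whole tower of derivatives insensitive to values off
  \<open>S\<close>, so such formulas may be substituted before differentiating again.\<close>

lemma higher_differentiable_on_cong:
  assumes "open S" "\<And>x. x \<in> S \<Longrightarrow> f x = g x"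
  shows "higher_differentiable_on S f n \<longleftrightarrow> higher_differentiable_on S g n"
  using assms(2)
proof (induction n arbitrary: f g)
  case 0
  then show ?case by (simp cong: continuous_on_cong)
next
  case (Suc n)
  have "frechet_derivative f (at x) v = frechet_derivative g (at x) v" if "x \<in> S" for x v
    using frechet_derivative_cong_open(1)[OF assms(1) that Suc.prems] by simp
  then have "higher_differentiable_on S (\<lambda>x. frechet_derivative f (at x) v) n \<longleftrightarrow>
      higher_differentiable_on S (\<lambda>x. frechet_derivative g (at x) v) n" for v
    by (rule Suc.IH)
  moreover have "f differentiable (at x) \<longleftrightarrow> g differentiable (at x)" if "x \<in> S" for x
    using frechet_derivative_cong_open(2)[OF assms(1) that Suc.prems] .
  ultimately show ?case by simp
qed

lemma higher_differentiable_on_subset: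
  assumes "higher_differentiable_on S f n" "T \<subseteq> S"
  shows "higher_differentiable_on T f n"
  using assms(1)
proof (induction n arbitrary: f)
  case 0
  then show ?case using assms(2) by (auto intro: continuous_on_subset)
next
  case (Suc n)
  then show ?case using assms(2) by auto
qed

text \<open>Level \<open>Suc n\<close> does not ask for continuity of \<open>f\<close> itself; it
  appears at the bottom of the induction, from differentiability. The product and chain rules use
  this to lower the level of the factor that is not differentiated.\<close>

lemma higher_differentiable_on_SucD:
  "higher_differentiable_on S f (Suc n) \<Longrightarrow> higher_differentiable_on S f n"
proof (induction n arbitrary: f)
  case 0
  then show ?case
    by (auto intro!: continuous_at_imp_continuous_on differentiable_imp_continuous_within)
next
  case (Suc n)
  have "higher_differentiable_on S (\<lambda>x. frechet_derivative f (at x) v) n" for v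
    using Suc.prems by (intro Suc.IH) (simp only: higher_differentiable_on.simps(2), blast)
  moreover have "\<forall>x\<in>S. f differentiable (at x)"
    using Suc.prems by (simp only: higher_differentiable_on.simps(2)) blast
  ultimately show ?case by simp
qed

lemma higher_differentiable_on_const: "higher_differentiable_on S (\<lambda>x. c) n"
  by (induction n arbitrary: c) (auto simp: frechet_derivative_const)

lemma higher_differentiable_on_bounded_linear:
  assumes "bounded_linear f"
  shows "higher_differentiable_on S f n"
proof (cases n)
  case 0
  then show ?thesis using assms by (simp add: linear_continuous_on)
next
  case (Suc m)
  have "frechet_derivative f (at x) = f" for x
    using frechet_derivative_at[OF bounded_linear_imp_has_derivative[OF assms]] by metis
  then show ?thesis
    using Suc assms by (simp add: higher_differentiable_on_const bounded_linear_imp_differentiable)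
qed

lemma higher_differentiable_on_add:
  assumes "open S" "higher_differentiable_on S f n" "higher_differentiable_on S g n"
  shows "higher_differentiable_on S (\<lambda>x. f x + g x) n"
  using assms(2,3)
proof (induction n arbitrary: f g)
  case 0
  then show ?case by (simp add: continuous_on_add)
next
  case (Suc n)
  have "frechet_derivative (\<lambda>x. f x + g x) (at x) v
      = frechet_derivative f (at x) v + frechet_derivative g (at x) v" if "x \<in> S" for x v
  proof -
    have "((\<lambda>x. f x + g x) has_derivative
        (\<lambda>v. frechet_derivative f (at x) v + frechet_derivative g (at x) v)) (at x)"
      using Suc.prems that by (intro has_derivative_add) (auto simp: frechet_derivative_works[symmetric])
    from frechet_derivative_at[OF this] show ?thesis by metis
  qed
  then have "higher_differentiable_on S (\<lambda>x. frechet_derivative (\<lambda>x. f x + g x) (at x) v) n" for v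
    using Suc by (subst higher_differentiable_on_cong[OF assms(1)]) auto
  then show ?case using Suc.prems by simp
qed

lemma higher_differentiable_on_mult:
  fixes f g :: "'a::real_normed_vector \<Rightarrow> real"
  assumes "open S" "higher_differentiable_on S f n" "higher_differentiable_on S g n"
  shows "higher_differentiable_on S (\<lambda>x. f x * g x) n"
  using assms(2,3)
proof (induction n arbitrary: f g)
  case 0
  then show ?case by (simp add: continuous_on_mult)
next
  case (Suc n)
  have "frechet_derivative (\<lambda>x. f x * g x) (at x) v
      = f x * frechet_derivative g (at x) v + frechet_derivative f (at x) v * g x" if "x \<in> S" for x v
  proof -
    have "((\<lambda>x. f x * g x) has_derivative
        (\<lambda>v. f x * frechet_derivative g (at x) v + frechet_derivative f (at x) v * g x)) (at x)"
      using Suc.prems that by (intro has_derivative_mult) (auto simp: frechet_derivative_works[symmetric])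
    from frechet_derivative_at[OF this] show ?thesis by metis
  qed
  moreover have "higher_differentiable_on S (\<lambda>x. f x * frechet_derivative g (at x) v
      + frechet_derivative f (at x) v * g x) n" for v
    using Suc.prems higher_differentiable_on_SucD[OF Suc.prems(1)] higher_differentiable_on_SucD[OF Suc.prems(2)]
    by (intro higher_differentiable_on_add[OF assms(1)] Suc.IH) auto
  ultimately have "higher_differentiable_on S (\<lambda>x. frechet_derivative (\<lambda>x. f x * g x) (at x) v) n" for v
    by (subst higher_differentiable_on_cong[OF assms(1)]) auto
  then show ?case using Suc.prems by simp
qed

text \<open>Induction with \<open>f\<close> fixed and \<open>h\<close> arbitrary: the derivative of
  the composite is the composite with \<open>h'\<close> times a derivative of \<open>f\<close>, so
  the induction hypothesis is applied to \<open>h'\<close> and the product rule does the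
  rest.\<close>

lemma higher_differentiable_on_compose_real:
  fixes f :: "'a::real_normed_vector \<Rightarrow> real" and h :: "real \<Rightarrow> real"
  assumes "open S" "f ` S \<subseteq> T" "higher_differentiable_on T h n" "higher_differentiable_on S f n"
  shows "higher_differentiable_on S (\<lambda>x. h (f x)) n"
  using assms(3,4)
proof (induction n arbitrary: h)
  case 0
  then show ?case using assms(2) by (auto intro: continuous_on_compose2)
next
  case (Suc n)
  have D: "((\<lambda>x. h (f x)) has_derivative
      (\<lambda>v. frechet_derivative h (at (f x)) 1 * frechet_derivative f (at x) v)) (at x)" if "x \<in> S" for x
  proof -
    have "h differentiable (at (f x))" using Suc.prems assms(2) that by auto
    then have h: "(h has_derivative frechet_derivative h (at (f x))) (at (f x))"
      by (simp add: frechet_derivative_works)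
    then have lin: "linear (frechet_derivative h (at (f x)))"
      using has_derivative_linear by blast
    have "(f has_derivative frechet_derivative f (at x)) (at x)"
      using Suc.prems that by (simp add: frechet_derivative_works[symmetric])
    from has_derivative_compose[OF this h]
    have "((\<lambda>x. h (f x)) has_derivative
      (\<lambda>v. frechet_derivative h (at (f x)) (frechet_derivative f (at x) v))) (at x)" .
    \<comment> \<open>A linear map on the reals is multiplication by its value at 1; this turns the
      derivative of \<open>h\<close> into a scalar function.\<close>
    moreover have "frechet_derivative h (at (f x)) c = frechet_derivative h (at (f x)) 1 * c" for c
      using linear_scale[OF lin, of c 1] by simp
    then have "(\<lambda>v. frechet_derivative h (at (f x)) (frechet_derivative f (at x) v))
        = (\<lambda>v. frechet_derivative h (at (f x)) 1 * frechet_derivative f (at x) v)"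
      by blast
    ultimately show ?thesis by simp
  qed
  have "frechet_derivative (\<lambda>x. h (f x)) (at x) v
      = frechet_derivative h (at (f x)) 1 * frechet_derivative f (at x) v" if "x \<in> S" for x v
    using frechet_derivative_at[OF D[OF that]] by metis
  moreover have "higher_differentiable_on S
      (\<lambda>x. frechet_derivative h (at (f x)) 1 * frechet_derivative f (at x) v) n" for v
  proof (rule higher_differentiable_on_mult[OF assms(1)])
    show "higher_differentiable_on S (\<lambda>x. frechet_derivative h (at (f x)) 1) n"
      using Suc.prems higher_differentiable_on_SucD[OF Suc.prems(2)]
      by (intro Suc.IH[of "\<lambda>y. frechet_derivative h (at y) 1"]) simp_all
    show "higher_differentiable_on S (\<lambda>x. frechet_derivative f (at x) v) n"
      using Suc.prems by simp
  qed
  ultimately have "higher_differentiable_on S (\<lambda>x. frechet_derivative (\<lambda>x. h (f x)) (at x) v) n" for v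
    by (subst higher_differentiable_on_cong[OF assms(1)]) auto
  then show ?case using D by (auto simp: differentiable_def)
qed

text \<open>For functions of one real variable a single ordinary derivative carries all directions;
  this drives the inductions for \<open>exp\<close>, \<open>sin\<close>, \<open>cos\<close> and
  \<open>ln\<close>.\<close>

lemma higher_differentiable_on_real_SucI:
  fixes h :: "real \<Rightarrow> real"
  assumes "open T" "\<And>x. x \<in> T \<Longrightarrow> (h has_real_derivative h' x) (at x)"
    and "higher_differentiable_on T h' n"
  shows "higher_differentiable_on T h (Suc n)"
proof -
  have "frechet_derivative h (at x) v = h' x * v" if "x \<in> T" for x v
    using frechet_derivative_at[OF assms(2)[OF that, unfolded has_field_derivative_def]] by metis
  then have "higher_differentiable_on T (\<lambda>x. frechet_derivative h (at x) v) n" for v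
    using higher_differentiable_on_mult[OF assms(1,3) higher_differentiable_on_const]
    by (subst higher_differentiable_on_cong[OF assms(1)]) auto
  then show ?thesis
    using assms(2) by (auto simp: has_field_derivative_def differentiable_def)
qed

section \<open>Smooth functions: closure rules and elementary examples\<close>

lemma smooth_on_subset: "smooth_on S f \<Longrightarrow> T \<subseteq> S \<Longrightarrow> smooth_on T f"
  unfolding smooth_on_def using higher_differentiable_on_subset by blast

lemma smooth_on_const: "smooth_on S (\<lambda>x. c)"
  by (simp add: smooth_on_def higher_differentiable_on_const)

lemma smooth_on_bounded_linear: "bounded_linear f \<Longrightarrow> smooth_on S f"
  by (simp add: smooth_on_def higher_differentiable_on_bounded_linear)

lemma smooth_on_add:
  "open S \<Longrightarrow> smooth_on S f \<Longrightarrow> smooth_on S g \<Longrightarrow> smooth_on S (\<lambda>x. f x + g x)"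
  by (simp add: smooth_on_def higher_differentiable_on_add)

lemma smooth_on_mult:
  fixes f g :: "'a::real_normed_vector \<Rightarrow> real"
  shows "open S \<Longrightarrow> smooth_on S f \<Longrightarrow> smooth_on S g \<Longrightarrow> smooth_on S (\<lambda>x. f x * g x)"
  by (simp add: smooth_on_def higher_differentiable_on_mult)

lemma smooth_on_compose_real:
  fixes f :: "'a::real_normed_vector \<Rightarrow> real" and h :: "real \<Rightarrow> real"
  assumes "smooth_on T h" "open S" "smooth_on S f" "f ` S \<subseteq> T"
  shows "smooth_on S (\<lambda>x. h (f x))"
  using assms higher_differentiable_on_compose_real unfolding smooth_on_def by blast

lemma smooth_on_exp: "smooth_on UNIV (exp :: real \<Rightarrow> real)"
proof -
  have "higher_differentiable_on UNIV (exp :: real \<Rightarrow> real) n" for n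
  proof (induction n)
    case 0
    then show ?case by (simp add: continuous_on_exp)
  next
    case (Suc n)
    then show ?case by (intro higher_differentiable_on_real_SucI[where h'=exp]) (auto intro: DERIV_exp)
  qed
  then show ?thesis by (simp add: smooth_on_def)
qed

text \<open>Each function is up to sign the derivative of the other, hence one simultaneous
  induction.\<close>

lemma smooth_on_sin_cos:
  "smooth_on UNIV (sin :: real \<Rightarrow> real)" "smooth_on UNIV (cos :: real \<Rightarrow> real)"
proof -
  have "higher_differentiable_on UNIV (sin :: real \<Rightarrow> real) n \<and>
      higher_differentiable_on UNIV (cos :: real \<Rightarrow> real) n" for n
  proof (induction n)
    case 0
    then show ?case by (simp add: continuous_on_sin continuous_on_cos)
  next
    case (Suc n)
    have "higher_differentiable_on UNIV (\<lambda>x::real. - 1 * sin x) n"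
      using Suc by (intro higher_differentiable_on_mult higher_differentiable_on_const) auto
    then have "higher_differentiable_on UNIV (cos :: real \<Rightarrow> real) (Suc n)"
      by (rule higher_differentiable_on_real_SucI[rotated 2]) (auto intro!: derivative_eq_intros)
    moreover have "higher_differentiable_on UNIV (sin :: real \<Rightarrow> real) (Suc n)"
      by (rule higher_differentiable_on_real_SucI[where h'=cos])
        (use Suc in \<open>auto intro!: derivative_eq_intros\<close>)
    ultimately show ?case by blast
  qed
  then show "smooth_on UNIV (sin :: real \<Rightarrow> real)" "smooth_on UNIV (cos :: real \<Rightarrow> real)"
    by (simp_all add: smooth_on_def)
qed

lemma smooth_on_ln: "smooth_on {0<..} (ln :: real \<Rightarrow> real)"
proof -
  \<comment> \<open>The reciprocal comes first: its derivative is minus its own square, so its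
    induction closes, and it is the derivative of \<open>ln\<close>.\<close>
  have inv: "higher_differentiable_on {0<..} (inverse :: real \<Rightarrow> real) n" for n
  proof (induction n)
    case 0
    then show ?case by (auto intro!: continuous_intros)
  next
    case (Suc n)
    have "higher_differentiable_on {0<..} (\<lambda>x::real. - 1 * (inverse x * inverse x)) n"
      using Suc by (intro higher_differentiable_on_mult higher_differentiable_on_const) auto
    then show ?case
      by (intro higher_differentiable_on_real_SucI[where h'="\<lambda>x. - 1 * (inverse x * inverse x)"])
        (auto intro!: derivative_eq_intros)
  qed
  have "higher_differentiable_on {0<..} (ln :: real \<Rightarrow> real) (Suc n)" for n
    by (intro higher_differentiable_on_real_SucI[where h'=inverse] inv)
      (auto intro!: derivative_eq_intros simp: inverse_eq_divide)
  then show ?thesis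
    unfolding smooth_on_def using higher_differentiable_on_SucD by blast
qed

lemma smooth_on_powr:
  fixes f :: "'a::real_normed_vector \<Rightarrow> real"
  assumes "open S" "smooth_on S f" "\<And>x. x \<in> S \<Longrightarrow> 0 < f x"
  shows "smooth_on S (\<lambda>x. f x powr a)"
proof -
  have "smooth_on S (\<lambda>x. exp (a * ln (f x)))"
    using assms
    by (intro smooth_on_compose_real[OF smooth_on_exp] smooth_on_mult smooth_on_const
        smooth_on_compose_real[OF smooth_on_ln]) auto
  moreover have "f x powr a = exp (a * ln (f x))" if "x \<in> S" for x
    using assms(3)[OF that] by (simp add: powr_def)
  ultimately show ?thesis
    unfolding smooth_on_def
    using higher_differentiable_on_cong[OF assms(1), of "\<lambda>x. f x powr a" "\<lambda>x. exp (a * ln (f x))"]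
    by blast
qed

lemma smooth_on_imp_continuous_on: "smooth_on S f \<Longrightarrow> continuous_on S f"
  unfolding smooth_on_def by (drule spec[of _ 0]) simp

lemma smooth_on_differentiable: "smooth_on S f \<Longrightarrow> x \<in> S \<Longrightarrow> f differentiable (at x)"
  unfolding smooth_on_def by (drule spec[of _ "Suc 0"]) simp

lemma smooth_on_frechet_derivative:
  "smooth_on S f \<Longrightarrow> smooth_on S (\<lambda>x. frechet_derivative f (at x) v)"
  unfolding smooth_on_def using higher_differentiable_on.simps(2) by blast

lemma smooth_on_deriv:
  fixes f :: "real \<Rightarrow> real"
  assumes "smooth_on UNIV f"
  shows "(f has_real_derivative deriv f x) (at x)" "smooth_on UNIV (deriv f)"
proof -
  have D: "(f has_real_derivative deriv f x) (at x)" for x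
    using smooth_on_differentiable[OF assms]
    by (simp add: DERIV_deriv_iff_real_differentiable)
  show "(f has_real_derivative deriv f x) (at x)" by (rule D)
  have "frechet_derivative f (at x) 1 = deriv f x" for x
    using frechet_derivative_at[OF D[unfolded has_field_derivative_def]] by (metis mult.right_neutral)
  then show "smooth_on UNIV (deriv f)"
    using smooth_on_frechet_derivative[OF assms, of 1] by simp
qed

lemma smooth_real_chain:
  assumes "smooth_on UNIV \<phi>" "(f has_real_derivative f') (at t)"
  shows "((\<lambda>t. \<phi> (f t)) has_real_derivative deriv \<phi> (f t) * f') (at t)"
  using DERIV_chain2[OF smooth_on_deriv(1)[OF assms(1)] assms(2)] by simp

subsection \<open>The Levi form as a Laplacian along holomorphic curves\<close>

lemma has_real_derivative_along_curve:
  fixes f :: "'a::real_normed_vector \<Rightarrow> real"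
  assumes "f differentiable (at (c t))" "(c has_vector_derivative v) (at t)"
  shows "((\<lambda>t. f (c t)) has_real_derivative frechet_derivative f (at (c t)) v) (at t)"
proof -
  have f: "(f has_derivative frechet_derivative f (at (c t))) (at (c t))"
    using assms(1) by (simp add: frechet_derivative_works)
  interpret linear "frechet_derivative f (at (c t))"
    using assms(1) linear_frechet_derivative by blast
  show ?thesis
    using has_derivative_compose[OF assms(2)[unfolded has_vector_derivative_def] f]
    by (simp add: has_field_derivative_def scale mult_commute_abs)
qed

section \<open>Second derivatives at a point\<close>

text \<open>The first derivative is hidden because only the value \<open>A\<close> is compared
  between different computations of it; being local, the notion survives changes of \<open>F\<close>
  away from \<open>x\<close>.\<close>

definition has_second_derivative :: "(real \<Rightarrow> real) \<Rightarrow> real \<Rightarrow> real \<Rightarrow> bool" where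
  "has_second_derivative F A x \<longleftrightarrow> (\<exists>F'. (\<forall>\<^sub>F t in nhds x. (F has_real_derivative F' t) (at t)) \<and>
     (F' has_real_derivative A) (at x))"

lemma has_second_derivativeI:
  assumes "open T" "x \<in> T" "\<And>t. t \<in> T \<Longrightarrow> (F has_real_derivative F' t) (at t)"
    and "(F' has_real_derivative A) (at x)"
  shows "has_second_derivative F A x"
  unfolding has_second_derivative_def eventually_nhds using assms by blast

text \<open>Two candidates for the first derivative agree near \<open>x\<close>. This identifies the
  second derivatives supplied by the Levi form with those computed explicitly along a curve.\<close>

lemma has_second_derivative_unique:
  assumes "has_second_derivative F A x" "has_second_derivative F B x"
  shows "A = B"
proof -
  obtain F' G' where F': "\<forall>\<^sub>F t in nhds x. (F has_real_derivative F' t) (at t)"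
      "(F' has_real_derivative A) (at x)"
    and G': "\<forall>\<^sub>F t in nhds x. (F has_real_derivative G' t) (at t)" "(G' has_real_derivative B) (at x)"
    using assms unfolding has_second_derivative_def by blast
  have "\<forall>\<^sub>F t in nhds x. F' t = G' t"
    using F'(1) G'(1) by eventually_elim (rule DERIV_unique)
  then have "(F' has_real_derivative B) (at x)"
    using DERIV_cong_ev[of x x F' G' B B] G'(2) by blast
  with F'(2) show ?thesis by (rule DERIV_unique)
qed

lemma has_second_derivative_diff:
  assumes "has_second_derivative F A x" "has_second_derivative G B x"
  shows "has_second_derivative (\<lambda>t. F t - G t) (A - B) x"
proof -
  obtain F' G' where F': "\<forall>\<^sub>F t in nhds x. (F has_real_derivative F' t) (at t)"
      "(F' has_real_derivative A) (at x)"
    and G': "\<forall>\<^sub>F t in nhds x. (G has_real_derivative G' t) (at t)" "(G' has_real_derivative B) (at x)"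
    using assms unfolding has_second_derivative_def by blast
  have "\<forall>\<^sub>F t in nhds x. ((\<lambda>t. F t - G t) has_real_derivative F' t - G' t) (at t)"
    using F'(1) G'(1) by eventually_elim (rule DERIV_diff)
  with DERIV_diff[OF F'(2) G'(2)] show ?thesis
    unfolding has_second_derivative_def by (intro exI[of _ "\<lambda>t. F' t - G' t"]) simp
qed

lemma has_second_derivative_cmult:
  assumes "has_second_derivative F A x"
  shows "has_second_derivative (\<lambda>t. c * F t) (c * A) x"
proof -
  obtain F' where F': "\<forall>\<^sub>F t in nhds x. (F has_real_derivative F' t) (at t)"
      "(F' has_real_derivative A) (at x)"
    using assms unfolding has_second_derivative_def by blast
  have "\<forall>\<^sub>F t in nhds x. ((\<lambda>t. c * F t) has_real_derivative c * F' t) (at t)"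
    using F'(1) by eventually_elim (rule DERIV_cmult)
  with DERIV_cmult[OF F'(2)] show ?thesis
    unfolding has_second_derivative_def by (intro exI[of _ "\<lambda>t. c * F' t"]) simp
qed

lemma has_second_derivative_cong:
  assumes "has_second_derivative F A x" "\<forall>\<^sub>F t in nhds x. F t = G t"
  shows "has_second_derivative G A x"
proof -
  obtain F' where F': "\<forall>\<^sub>F t in nhds x. (F has_real_derivative F' t) (at t)"
      "(F' has_real_derivative A) (at x)"
    using assms unfolding has_second_derivative_def by blast
  have "\<forall>\<^sub>F t in nhds x. \<forall>\<^sub>F u in nhds t. F u = G u"
    using assms(2) by (simp add: eventually_eventually)
  with F'(1) have "\<forall>\<^sub>F t in nhds x. (G has_real_derivative F' t) (at t)"
    by eventually_elim (metis DERIV_cong_ev)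
  with F'(2) show ?thesis unfolding has_second_derivative_def by blast
qed

text \<open>The first derivative vanishes at \<open>x\<close>; if \<open>A > 0\<close> it is
  positive just to the right, and the mean value theorem makes \<open>F\<close> exceed its maximum
  there.\<close>

lemma has_second_derivative_local_max:
  assumes "has_second_derivative F A x" "\<forall>\<^sub>F t in nhds x. F t \<le> F x"
  shows "A \<le> 0"
proof (rule ccontr)
  assume "\<not> A \<le> 0"
  obtain F' where F': "\<forall>\<^sub>F t in nhds x. (F has_real_derivative F' t) (at t)"
      "(F' has_real_derivative A) (at x)"
    using assms unfolding has_second_derivative_def by blast
  obtain e where e: "e > 0" "\<And>t. dist t x < e \<Longrightarrow> (F has_real_derivative F' t) (at t) \<and> F t \<le> F x"
    using eventually_conj[OF F'(1) assms(2)] unfolding eventually_nhds_metric by blast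
  have "F' x = 0"
    by (rule DERIV_local_max[of F _ x e]) (use e in \<open>auto simp: dist_real_def\<close>)
  obtain d where d: "d > 0" "\<And>h. 0 < h \<Longrightarrow> h < d \<Longrightarrow> F' x < F' (x + h)"
    using DERIV_pos_inc_right[OF F'(2)] \<open>\<not> A \<le> 0\<close> by auto
  define h where "h = min d e / 2"
  have h: "0 < h" "h < d" "h < e" using d(1) e(1) by (auto simp: h_def)
  have "\<exists>z. x < z \<and> z < x + h \<and> F (x + h) - F x = (x + h - x) * F' z"
    using h e by (intro MVT2) (auto simp: dist_real_def)
  then obtain z where z: "x < z" "z < x + h" "F (x + h) - F x = h * F' z" by auto
  have "0 < F' z" using d(2)[of "z - x"] z h \<open>F' x = 0\<close> by auto
  then have "F x < F (x + h)" using z(3) h by (metis diff_gt_0_iff_gt mult_pos_pos)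
  moreover have "F (x + h) \<le> F x" using e(2)[of "x + h"] h by (simp add: dist_real_def)
  ultimately show False by simp
qed

text \<open>Along a curve the direction of differentiation moves. Expanding it in a basis leaves
  derivatives in fixed directions, the only ones \<open>higher_differentiable_on\<close>
  differentiates again.\<close>

lemma frechet_derivative_basis_sum:
  fixes f :: "'a::euclidean_space \<Rightarrow> real"
  assumes "f differentiable (at x)"
  shows "frechet_derivative f (at x) v = (\<Sum>b\<in>Basis. (v \<bullet> b) * frechet_derivative f (at x) b)"
proof -
  interpret linear "frechet_derivative f (at x)"
    using assms linear_frechet_derivative by blast
  have "frechet_derivative f (at x) v = frechet_derivative f (at x) (\<Sum>b\<in>Basis. (v \<bullet> b) *\<^sub>R b)"
    by (simp add: euclidean_representation)
  then show ?thesis by (simp add: sum scale)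
qed

text \<open>Second-order chain rule: the acceleration contributes a first derivative of
  \<open>f\<close>, the velocity a second one.\<close>

lemma has_second_derivative_along_curve:
  fixes f :: "'a::euclidean_space \<Rightarrow> real" and c c' :: "real \<Rightarrow> 'a"
  assumes "open S" "higher_differentiable_on S f 2" "c t0 \<in> S"
    and c: "\<And>t. (c has_vector_derivative c' t) (at t)" and c': "(c' has_vector_derivative m) (at t0)"
  shows "has_second_derivative (\<lambda>t. f (c t))
     (frechet_derivative f (at (c t0)) m +
      frechet_derivative (\<lambda>x. frechet_derivative f (at x) (c' t0)) (at (c t0)) (c' t0)) t0"
proof -
  define D where "D b x = frechet_derivative f (at x) b" for b x
  have df: "f differentiable (at x)" if "x \<in> S" for x
    using assms(2) that by (simp add: numeral_2_eq_2)
  have dD: "D b differentiable (at x)" if "x \<in> S" for x b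
    using assms(2) that by (simp add: numeral_2_eq_2 D_def[abs_def])
  have chain: "((\<lambda>t. g (c t)) has_real_derivative frechet_derivative g (at (c t)) (c' t)) (at t)"
    if "g differentiable (at (c t))" for g :: "'a \<Rightarrow> real" and t
    using has_real_derivative_along_curve[OF that c] .
  have contc: "continuous_on UNIV c"
    using c has_vector_derivative_continuous continuous_at_imp_continuous_on by blast
  define T where "T = c -` S"
  have T: "open T" "t0 \<in> T"
    using open_vimage[OF assms(1) contc] assms(3) by (auto simp: T_def)
  have expand: "D v x = (\<Sum>b\<in>Basis. (v \<bullet> b) * D b x)" if "x \<in> S" for v x
    unfolding D_def using frechet_derivative_basis_sum[OF df[OF that]] .
  have "((\<lambda>t. \<Sum>b\<in>Basis. (c' t \<bullet> b) * D b (c t)) has_real_derivative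
      (\<Sum>b\<in>Basis. (m \<bullet> b) * D b (c t0) + frechet_derivative (D b) (at (c t0)) (c' t0) * (c' t0 \<bullet> b))) (at t0)"
  proof (intro DERIV_sum DERIV_mult chain dD assms(3))
    fix b :: 'a
    have "((\<lambda>t. c' t \<bullet> b) has_vector_derivative m \<bullet> b) (at t0)"
      by (rule bounded_linear.has_vector_derivative[OF bounded_linear_inner_left c'])
    then show "((\<lambda>t. c' t \<bullet> b) has_real_derivative m \<bullet> b) (at t0)"
      by (simp add: has_real_derivative_iff_has_vector_derivative)
  qed
  \<comment> \<open>The basis sums are folded back: with the velocity frozen at \<open>t0\<close>,
    the directional derivative of \<open>f\<close> is on \<open>S\<close> a constant-coefficient
    combination of the \<open>D b\<close>, so its derivative is the same combination.\<close>
  moreover have "(\<Sum>b\<in>Basis. (m \<bullet> b) * D b (c t0) + frechet_derivative (D b) (at (c t0)) (c' t0) * (c' t0 \<bullet> b))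
    = D m (c t0) + frechet_derivative (D (c' t0)) (at (c t0)) (c' t0)"
  proof -
    have "((\<lambda>x. \<Sum>b\<in>Basis. (c' t0 \<bullet> b) * D b x) has_derivative
        (\<lambda>w. \<Sum>b\<in>Basis. (c' t0 \<bullet> b) * frechet_derivative (D b) (at (c t0)) w)) (at (c t0))"
      using dD[OF assms(3)]
      by (intro has_derivative_sum has_derivative_mult_right) (simp add: frechet_derivative_works)
    then have "(D (c' t0) has_derivative
        (\<lambda>w. \<Sum>b\<in>Basis. (c' t0 \<bullet> b) * frechet_derivative (D b) (at (c t0)) w)) (at (c t0))"
      by (rule has_derivative_transform_within_open[OF _ assms(1,3)]) (simp add: expand)
    from frechet_derivative_at[OF this]
    have "frechet_derivative (D (c' t0)) (at (c t0)) (c' t0)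
      = (\<Sum>b\<in>Basis. (c' t0 \<bullet> b) * frechet_derivative (D b) (at (c t0)) (c' t0))" by metis
    with expand[OF assms(3), of m] show ?thesis
      by (simp add: sum.distrib mult.commute)
  qed
  ultimately have d2: "((\<lambda>t. \<Sum>b\<in>Basis. (c' t \<bullet> b) * D b (c t)) has_real_derivative
      D m (c t0) + frechet_derivative (D (c' t0)) (at (c t0)) (c' t0)) (at t0)" by simp
  have d1: "((\<lambda>t. f (c t)) has_real_derivative (\<Sum>b\<in>Basis. (c' t \<bullet> b) * D b (c t))) (at t)"
    if "t \<in> T" for t
    using chain[OF df, of t] expand[of "c t" "c' t"] that by (simp add: T_def D_def)
  show ?thesis
    using has_second_derivativeI[OF T d1 d2] by (simp add: D_def[abs_def])
qed

section \<open>The Levi form in terms of real second derivatives\<close>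

lemma wirtinger_wirtinger_bar_of_real:
  fixes f :: "complex ^ 'n::finite \<Rightarrow> real"
  assumes "open S" "higher_differentiable_on S f 2" "z \<in> S"
  defines "B \<equiv> \<lambda>v w. frechet_derivative (\<lambda>x. frechet_derivative f (at x) w) (at z) v"
  shows "wirtinger j (wirtinger_bar k (\<lambda>x. complex_of_real (f x))) z =
    ((of_real (B (axis j 1) (axis k 1)) + \<i> * of_real (B (axis j 1) (axis k \<i>)))
     - \<i> * (of_real (B (axis j \<i>) (axis k 1)) + \<i> * of_real (B (axis j \<i>) (axis k \<i>)))) / 4"
proof -
  define D where "D b x = frechet_derivative f (at x) b" for b x
  have df: "(f has_derivative frechet_derivative f (at x)) (at x)" if "x \<in> S" for x
    using assms(2) that by (simp add: numeral_2_eq_2 frechet_derivative_works[symmetric])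
  have dD: "(D b has_derivative (\<lambda>v. B v b)) (at z)" for b
    using assms(2,3) by (simp add: numeral_2_eq_2 D_def[abs_def] B_def frechet_derivative_works[symmetric])
  have "frechet_derivative (\<lambda>x. complex_of_real (f x)) (at x) v = of_real (D v x)" if "x \<in> S" for x v
  proof -
    have "((\<lambda>x. complex_of_real (f x)) has_derivative (\<lambda>v. of_real (D v x))) (at x)"
      unfolding D_def by (intro has_derivative_of_real df that)
    from frechet_derivative_at[OF this] show ?thesis by metis
  qed
  then have bar: "wirtinger_bar k (\<lambda>x. complex_of_real (f x)) x
      = (of_real (D (axis k 1) x) + \<i> * of_real (D (axis k \<i>) x)) / 2" if "x \<in> S" for x
    using that by (simp add: wirtinger_bar_def)
  have "((\<lambda>x. (of_real (D (axis k 1) x) + \<i> * of_real (D (axis k \<i>) x)) / 2) has_derivative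
      (\<lambda>v. (of_real (B v (axis k 1)) + \<i> * of_real (B v (axis k \<i>))) / 2)) (at z)"
    by (intro bounded_linear.has_derivative[OF bounded_linear_divide] has_derivative_add
        has_derivative_mult_right has_derivative_of_real dD)
  then have "(wirtinger_bar k (\<lambda>x. complex_of_real (f x)) has_derivative
      (\<lambda>v. (of_real (B v (axis k 1)) + \<i> * of_real (B v (axis k \<i>))) / 2)) (at z)"
    by (rule has_derivative_transform_within_open[OF _ assms(1,3)]) (simp add: bar)
  from fun_cong[OF frechet_derivative_at[OF this], symmetric]
  have dw: "frechet_derivative (wirtinger_bar k (\<lambda>x. complex_of_real (f x))) (at z) v
    = (of_real (B v (axis k 1)) + \<i> * of_real (B v (axis k \<i>))) / 2" for v .
  show ?thesis unfolding wirtinger_def dw by (simp add: field_simps)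
qed

lemma complex_vec_axis_sum:
  fixes t :: "complex ^ 'n::finite"
  shows "t = (\<Sum>j\<in>UNIV. Re (t $ j) *\<^sub>R axis j 1 + Im (t $ j) *\<^sub>R axis j \<i>)"
  by (simp add: vec_eq_iff sum_component axis_def sum.distrib if_distrib complex_eq_iff
      cong: if_cong)

text \<open>The right side is the Laplacian of \<open>f\<close> on the complex line through
  \<open>z\<close> in direction \<open>t\<close>, and the Laplacian is four times the mixed
  Wirtinger derivative. Expanded in coordinates, both sides agree for each pair \<open>j\<close>,
  \<open>k\<close> separately.\<close>

lemma Re_levi_form:
  fixes f :: "complex ^ 'n::finite \<Rightarrow> real"
  assumes "open S" "higher_differentiable_on S f 2" "z \<in> S"
  defines "B \<equiv> \<lambda>v w. frechet_derivative (\<lambda>x. frechet_derivative f (at x) w) (at z) v"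
  shows "4 * Re (levi_form f z t) = B t t + B (\<i> *s t) (\<i> *s t)"
proof -
  have df: "f differentiable (at x)" if "x \<in> S" for x
    using assms(2) that by (simp add: numeral_2_eq_2)
  have dD: "(\<lambda>x. frechet_derivative f (at x) b) differentiable (at z)" for b
    using assms(2,3) by (simp add: numeral_2_eq_2)
  have lin1: "linear (\<lambda>v. B v w)" for w
    unfolding B_def by (rule linear_frechet_derivative[OF dD])
  \<comment> \<open>Here \<open>w\<close> sits inside the function being differentiated, so
    linearity must first be used at all points of \<open>S\<close> and then differentiated.\<close>
  have lin2: "linear (\<lambda>w. B v w)" for v
  proof (rule linearI)
    have *: "B v w = L v" if "((\<lambda>x. frechet_derivative f (at x) w) has_derivative L) (at z)" for w L
      using frechet_derivative_at[OF that] by (simp add: B_def)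
    have d: "((\<lambda>x. frechet_derivative f (at x) w) has_derivative (\<lambda>v. B v w)) (at z)" for w
      unfolding B_def using dD by (simp add: frechet_derivative_works[symmetric])
    show "B v (x + y) = B v x + B v y" for x y
      by (rule *, rule has_derivative_transform_within_open[OF has_derivative_add[OF d d] assms(1,3)])
        (simp add: linear_add[OF linear_frechet_derivative[OF df]])
    show "B v (r *\<^sub>R x) = r *\<^sub>R B v x" for r x
      by (rule *, rule has_derivative_transform_within_open[OF has_derivative_scaleR_right[OF d] assms(1,3)])
        (simp add: linear_scale[OF linear_frechet_derivative[OF df]])
  qed
  have expand: "B s s = (\<Sum>j\<in>UNIV. \<Sum>k\<in>UNIV.
      Re (s $ j) * Re (s $ k) * B (axis j 1) (axis k 1) + Re (s $ j) * Im (s $ k) * B (axis j 1) (axis k \<i>)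
    + Im (s $ j) * Re (s $ k) * B (axis j \<i>) (axis k 1) + Im (s $ j) * Im (s $ k) * B (axis j \<i>) (axis k \<i>))"
    (is "_ = ?rhs s") for s
  proof -
    have 1: "B v s = (\<Sum>k\<in>UNIV. Re (s $ k) * B v (axis k 1) + Im (s $ k) * B v (axis k \<i>))" for v
      by (subst complex_vec_axis_sum[of s])
        (simp add: linear_sum[OF lin2] linear_add[OF lin2] linear_scale[OF lin2])
    have 2: "B s w = (\<Sum>j\<in>UNIV. Re (s $ j) * B (axis j 1) w + Im (s $ j) * B (axis j \<i>) w)" for w
      by (subst complex_vec_axis_sum[of s])
        (simp add: linear_sum[OF lin1] linear_add[OF lin1] linear_scale[OF lin1])
    show ?thesis
      unfolding 2[of s] unfolding 1
      by (simp add: sum_distrib_left sum.distrib[symmetric] algebra_simps)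
  qed
  have w: "wirtinger j (wirtinger_bar k (\<lambda>x. complex_of_real (f x))) z =
    ((of_real (B (axis j 1) (axis k 1)) + \<i> * of_real (B (axis j 1) (axis k \<i>)))
     - \<i> * (of_real (B (axis j \<i>) (axis k 1)) + \<i> * of_real (B (axis j \<i>) (axis k \<i>)))) / 4" for j k
    unfolding B_def by (rule wirtinger_wirtinger_bar_of_real[OF assms(1-3)])
  have aux: "4 * Re (((of_real P + \<i> * of_real Q) - \<i> * (of_real R + \<i> * of_real T)) / 4 * a * cnj b)
    = (Re a * Re b + Im a * Im b) * (P + T) + (Re a * Im b - Im a * Re b) * (Q - R)"
    for P Q R T :: real and a b :: complex
    by (simp add: field_simps)
  have "4 * Re (levi_form f z t) = (\<Sum>j\<in>UNIV. \<Sum>k\<in>UNIV.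
      (Re (t $ j) * Re (t $ k) + Im (t $ j) * Im (t $ k)) * (B (axis j 1) (axis k 1) + B (axis j \<i>) (axis k \<i>))
    + (Re (t $ j) * Im (t $ k) - Im (t $ j) * Re (t $ k)) * (B (axis j 1) (axis k \<i>) - B (axis j \<i>) (axis k 1)))"
    unfolding levi_form_def w Re_sum sum_distrib_left aux ..
  also have "\<dots> = ?rhs t + ?rhs (\<i> *s t)"
    unfolding sum.distrib[symmetric] by (intro sum.cong refl) (simp add: algebra_simps)
  finally show ?thesis by (simp add: expand)
qed

text \<open>The opposite accelerations \<open>m\<close> and \<open>- m\<close> make the first-order
  terms cancel in the sum, leaving only the Levi form.\<close>

lemma Re_levi_form_laplacian:
  fixes f :: "complex ^ 'n::finite \<Rightarrow> real"
  assumes "open S" "higher_differentiable_on S f 2" "z \<in> S"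
    and "c1 0 = z" "\<And>x. (c1 has_vector_derivative c1' x) (at x)" "(c1' has_vector_derivative m) (at 0)"
    and "c2 0 = z" "\<And>x. (c2 has_vector_derivative c2' x) (at x)" "(c2' has_vector_derivative - m) (at 0)"
    and "c1' 0 = t" "c2' 0 = \<i> *s t"
  shows "\<exists>a b. has_second_derivative (\<lambda>x. f (c1 x)) a 0 \<and> has_second_derivative (\<lambda>x. f (c2 x)) b 0 \<and>
    a + b = 4 * Re (levi_form f z t)"
proof -
  have "f differentiable (at z)" using assms(2,3) by (simp add: numeral_2_eq_2)
  then have "frechet_derivative f (at z) (- m) = - frechet_derivative f (at z) m"
    using linear_frechet_derivative linear_neg by blast
  then show ?thesis
    using has_second_derivative_along_curve[of S f c1 0 c1' m] has_second_derivative_along_curve[of S f c2 0 c2' "- m"]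
      Re_levi_form[OF assms(1-3), of t] assms
    by fastforce
qed

subsection \<open>Geometry of worm domains\<close>

text \<open>This is \<open>|z - exp (i s)|^2 - (1 - \<phi> s)\<close> multiplied out, using
  \<open>|exp (i s)| = 1\<close>; in this form smoothness and derivatives are read off from real
  functions.\<close>

definition worm_fun :: "(real \<Rightarrow> real) \<Rightarrow> complex ^ 2 \<Rightarrow> real" where
  "worm_fun \<phi> p = (cmod (p $ 1))\<^sup>2
     - 2 * (Re (p $ 1) * cos (ln ((cmod (p $ 2))\<^sup>2)) + Im (p $ 1) * sin (ln ((cmod (p $ 2))\<^sup>2)))
     + \<phi> (ln ((cmod (p $ 2))\<^sup>2))"

definition pair_vec :: "complex \<Rightarrow> complex \<Rightarrow> complex ^ 2" where
  "pair_vec z w = axis 1 z + axis 2 w"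

lemma pair_vec_nth [simp]: "pair_vec z w $ 1 = z" "pair_vec z w $ 2 = w"
  by (simp_all add: pair_vec_def axis_def)

lemma pair_vec_eta [simp]: "pair_vec (p $ 1) (p $ 2) = p"
  by (simp add: vec_eq_iff forall_2)

lemma scale_pair_vec: "c *s pair_vec z w = pair_vec (c * z) (c * w)" "r *\<^sub>R pair_vec z w = pair_vec (r *\<^sub>R z) (r *\<^sub>R w)"
  by (simp_all add: vec_eq_iff forall_2)

lemma bounded_linear_axis: "bounded_linear (axis i :: 'a::euclidean_space \<Rightarrow> 'a ^ 'n::finite)"
  unfolding linear_conv_bounded_linear[symmetric]
  by (rule linearI) (simp_all add: vec_eq_iff axis_def)

lemma pair_vec_has_vector_derivative:
  assumes "(f has_vector_derivative f') F" "(g has_vector_derivative g') F"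
  shows "((\<lambda>t. pair_vec (f t) (g t)) has_vector_derivative pair_vec f' g') F"
  unfolding pair_vec_def
  by (intro has_vector_derivative_add bounded_linear.has_vector_derivative[OF bounded_linear_axis] assms)

lemma continuous_on_pair_vec:
  assumes "continuous_on S f" "continuous_on S g"
  shows "continuous_on S (\<lambda>t. pair_vec (f t) (g t))"
  unfolding pair_vec_def
  by (intro continuous_on_add bounded_linear.continuous_on[OF bounded_linear_axis] assms)

lemma worm_domain_eq: "worm_domain \<phi> = {p. p $ 2 \<noteq> 0 \<and> worm_fun \<phi> p < 0}"
proof -
  have eq: "(cmod (z - exp (\<i> * complex_of_real s)))\<^sup>2 - (1 - t) =
      (cmod z)\<^sup>2 - 2 * (Re z * cos s + Im z * sin s) + t" for z s t
  proof -
    have "(cmod (z - cis s))\<^sup>2 = (Re z - cos s)\<^sup>2 + (Im z - sin s)\<^sup>2"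
      by (simp add: cmod_power2)
    also have "\<dots> = (cmod z)\<^sup>2 - 2 * (Re z * cos s + Im z * sin s) + ((sin s)\<^sup>2 + (cos s)\<^sup>2)"
      unfolding cmod_power2 by (simp add: power2_diff algebra_simps del: sin_cos_squared_add sin_cos_squared_add2)
    finally show ?thesis by (simp add: cis_conv_exp)
  qed
  show ?thesis unfolding worm_domain_def worm_fun_def Let_def eq ..
qed

lemma open_nonzero_snd: "open {p :: complex ^ 2. p $ 2 \<noteq> 0}"
  by (intro open_Collect_neq continuous_intros)

lemma smooth_on_ln_cmod_snd: "smooth_on {p :: complex ^ 2. p $ 2 \<noteq> 0} (\<lambda>p. ln ((cmod (p $ 2))\<^sup>2))"
proof -
  have "bounded_linear (\<lambda>p :: complex ^ 2. Re (p $ 2))" "bounded_linear (\<lambda>p :: complex ^ 2. Im (p $ 2))"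
    using bounded_linear_compose[OF bounded_linear_Re bounded_linear_vec_nth]
      bounded_linear_compose[OF bounded_linear_Im bounded_linear_vec_nth] by auto
  then have "smooth_on {p :: complex ^ 2. p $ 2 \<noteq> 0}
      (\<lambda>p. ln (Re (p $ 2) * Re (p $ 2) + Im (p $ 2) * Im (p $ 2)))"
    by (intro smooth_on_compose_real[OF smooth_on_ln] open_nonzero_snd smooth_on_add smooth_on_mult
        smooth_on_bounded_linear) (auto simp: complex_eq_iff not_sum_squares_lt_zero sum_squares_gt_zero_iff)
  moreover have "(cmod x)\<^sup>2 = Re x * Re x + Im x * Im x" for x
    unfolding cmod_power2 unfolding power2_eq_square ..
  ultimately show ?thesis by (simp only:)
qed

lemma smooth_on_worm_fun:
  assumes "smooth_on UNIV \<phi>"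
  shows "smooth_on {p :: complex ^ 2. p $ 2 \<noteq> 0} (worm_fun \<phi>)"
proof -
  have bl: "bounded_linear (\<lambda>p :: complex ^ 2. Re (p $ 1))" "bounded_linear (\<lambda>p :: complex ^ 2. Im (p $ 1))"
    using bounded_linear_compose[OF bounded_linear_Re bounded_linear_vec_nth]
      bounded_linear_compose[OF bounded_linear_Im bounded_linear_vec_nth] by auto
  note comp = smooth_on_compose_real[OF _ open_nonzero_snd smooth_on_ln_cmod_snd subset_UNIV]
  have "(cmod x)\<^sup>2 = Re x * Re x + Im x * Im x" for x
    unfolding cmod_power2 unfolding power2_eq_square ..
  then have eq: "worm_fun \<phi> = (\<lambda>p. Re (p $ 1) * Re (p $ 1) + Im (p $ 1) * Im (p $ 1)
     + (- 2) * (Re (p $ 1) * cos (ln ((cmod (p $ 2))\<^sup>2)) + Im (p $ 1) * sin (ln ((cmod (p $ 2))\<^sup>2)))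
     + \<phi> (ln ((cmod (p $ 2))\<^sup>2)))"
    by (intro ext) (simp add: worm_fun_def)
  show ?thesis
    unfolding eq
    by (intro smooth_on_add smooth_on_mult smooth_on_const smooth_on_bounded_linear open_nonzero_snd
        bl comp assms smooth_on_sin_cos)
qed

text \<open>The values \<open>a = 1\<close> and \<open>a = \<i>\<close> give the two real directions
  in which Laplacians are taken later.\<close>

lemma has_vector_derivative_complex_line:
  fixes g :: "complex \<Rightarrow> complex"
  assumes "(g has_field_derivative g') (at (of_real t * a))"
  shows "((\<lambda>t. g (of_real t * a)) has_vector_derivative a * g') (at t)"
proof -
  have "((\<lambda>t. of_real t * a) has_vector_derivative a) (at t)"
    by (auto intro!: derivative_eq_intros)
  from field_vector_diff_chain_at[OF this assms] show ?thesis
    by (simp add: o_def)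
qed

lemma ln_cmod_exp: "w \<noteq> 0 \<Longrightarrow> ln ((cmod (w * exp u))\<^sup>2) = ln ((cmod w)\<^sup>2) + 2 * Re u"
  by (simp add: norm_mult power_mult_distrib ln_mult ln_realpow)

lemma open_worm_domain:
  assumes "smooth_on UNIV \<phi>"
  shows "open (worm_domain \<phi>)"
proof -
  have "open ({p. p $ 2 \<noteq> 0} \<inter> worm_fun \<phi> -` {..<0})"
    by (rule continuous_open_preimage[OF smooth_on_imp_continuous_on[OF smooth_on_worm_fun[OF assms]] open_nonzero_snd])
      simp
  moreover have "{p. p $ 2 \<noteq> 0} \<inter> worm_fun \<phi> -` {..<0} = worm_domain \<phi>"
    by (auto simp: worm_domain_eq)
  ultimately show ?thesis by simp
qed

text \<open>Two test directions suffice. Moving \<open>z\<close> away from \<open>cis s\<close>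
  gives \<open>2 * |z - cis s|^2\<close>; if this vanishes then \<open>z = cis s\<close>, the
  equation of the boundary forces \<open>\<phi> s = 1\<close>, and moving \<open>|w|\<close> gives
  \<open>deriv \<phi> s\<close>, which is then nonzero.\<close>

lemma frechet_derivative_worm_fun_nonzero:
  assumes "smooth_on UNIV \<phi>" "\<forall>x. \<phi> x = 1 \<longrightarrow> deriv \<phi> x \<noteq> 0" "p $ 2 \<noteq> 0" "worm_fun \<phi> p = 0"
  shows "frechet_derivative (worm_fun \<phi>) (at p) \<noteq> (\<lambda>v. 0)"
proof
  assume D0: "frechet_derivative (worm_fun \<phi>) (at p) = (\<lambda>v. 0)"
  define z w s where "z = p $ 1" and "w = p $ 2" and "s = ln ((cmod (p $ 2))\<^sup>2)"
  have p: "p = pair_vec z w" by (simp add: z_def w_def)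
  have sw: "ln ((cmod w)\<^sup>2) = s" by (simp add: w_def s_def)
  have diff: "worm_fun \<phi> differentiable (at p)"
    using smooth_on_differentiable[OF smooth_on_worm_fun[OF assms(1)]] assms(3) by auto
  have along: "((\<lambda>t. worm_fun \<phi> (c t)) has_real_derivative 0) (at 0)"
    if "c 0 = p" "(c has_vector_derivative v) (at 0)" for c v
    using has_real_derivative_along_curve[of "worm_fun \<phi>" c 0 v] that diff D0 by simp
  have sc1: "cos s * (cos s * 2) + sin s * (sin s * 2) = 2"
  proof -
    have "cos s * (cos s * 2) + sin s * (sin s * 2) = 2 * (cos s * cos s + sin s * sin s)"
      by (simp only: algebra_simps)
    then show ?thesis by simp
  qed
  define v where "v = z - cis s"
  have "((\<lambda>t. worm_fun \<phi> (pair_vec (z + t *\<^sub>R v) w)) has_real_derivative 0) (at 0)"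
    by (rule along[of _ "pair_vec v 0"])
      (auto simp: p intro!: pair_vec_has_vector_derivative derivative_eq_intros)
  moreover have "((\<lambda>t. worm_fun \<phi> (pair_vec (z + t *\<^sub>R v) w)) has_real_derivative 2 * (cmod v)\<^sup>2) (at 0)"
    unfolding worm_fun_def pair_vec_nth sw unfolding cmod_power2
    by (auto intro!: derivative_eq_intros simp: v_def power2_eq_square algebra_simps sc1)
  ultimately have "2 * (cmod v)\<^sup>2 = 0" by (metis DERIV_unique)
  then have z: "z = cis s" by (simp add: v_def)
  have "\<phi> s = 1"
    using assms(4) unfolding worm_fun_def z_def[symmetric] s_def[symmetric] z
    by (simp flip: power2_eq_square)
  then have "deriv \<phi> s \<noteq> 0" using assms(2) by blast
  have sc: "ln ((cmod (w * exp (of_real t / 2)))\<^sup>2) = s + t" for t :: real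
    using ln_cmod_exp[of w "of_real t / 2"] assms(3) sw by (simp add: w_def)
  \<comment> \<open>The curve moves \<open>s\<close> at unit speed with \<open>z\<close> fixed; at
    \<open>z = cis s\<close> the trigonometric part is stationary, so only the profile
    contributes.\<close>
  have "((\<lambda>t::real. worm_fun \<phi> (pair_vec z (w * exp (of_real t / 2)))) has_real_derivative 0) (at 0)"
  proof (rule along[of _ "pair_vec 0 (w / 2)"])
    have "((\<lambda>u. w * exp (u / 2)) has_field_derivative w / 2) (at (of_real 0 * 1))"
      by (auto intro!: derivative_eq_intros)
    from has_vector_derivative_complex_line[OF this]
    have "((\<lambda>t. w * exp (complex_of_real t / 2)) has_vector_derivative w / 2) (at 0)" by simp
    then show "((\<lambda>t. pair_vec z (w * exp (complex_of_real t / 2))) has_vector_derivative pair_vec 0 (w / 2)) (at 0)"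
      by (intro pair_vec_has_vector_derivative) auto
  qed (simp add: p)
  moreover have "((\<lambda>t::real. worm_fun \<phi> (pair_vec z (w * exp (of_real t / 2)))) has_real_derivative deriv \<phi> s) (at 0)"
  proof -
    have "((\<lambda>t. \<phi> (s + t)) has_real_derivative deriv \<phi> s) (at 0)"
      using smooth_real_chain[OF assms(1) DERIV_add[OF DERIV_const[of s] DERIV_ident], of 0] by simp
    then show ?thesis
      unfolding worm_fun_def pair_vec_nth sc
      by (auto intro!: derivative_eq_intros simp: z sc1 mult.commute)
  qed
  ultimately show False using \<open>deriv \<phi> s \<noteq> 0\<close> DERIV_unique by blast
qed

section \<open>Closure and boundary of the worm\<close>

text \<open>The bound on the profile keeps the domain away from \<open>w = 0\<close>, so continuity
  of \<open>worm_fun\<close> gives one inclusion. Conversely, a zero of \<open>worm_fun\<close>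
  outside the closure would be a local minimum, against the nonvanishing derivative.\<close>

lemma closure_worm_domain:
  assumes "smooth_on UNIV \<phi>" "\<forall>x. \<phi> x = 1 \<longrightarrow> deriv \<phi> x \<noteq> 0"
    and "\<forall>x. x < - a \<or> x > a \<longrightarrow> \<phi> x > 1"
  shows "closure (worm_domain \<phi>) = {p. p $ 2 \<noteq> 0 \<and> worm_fun \<phi> p \<le> 0}"
proof (intro equalityI subsetI)
  fix p assume p: "p \<in> closure (worm_domain \<phi>)"
  have "exp (- a) \<le> (cmod (q $ 2))\<^sup>2" if "q \<in> worm_domain \<phi>" for q
  proof -
    define s where "s = ln ((cmod (q $ 2))\<^sup>2)"
    have "\<phi> s \<le> 1"
      using that zero_le_power2[of "cmod (q $ 1 - exp (\<i> * complex_of_real s))"]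
      unfolding worm_domain_def Let_def s_def mem_Collect_eq by linarith
    then have "- a \<le> s" using assms(3) by (metis not_less)
    then show ?thesis
      using that by (simp add: s_def worm_domain_eq ln_ge_iff)
  qed
  then have "worm_domain \<phi> \<subseteq> {q. exp (- a) \<le> (cmod (q $ 2))\<^sup>2}" by blast
  moreover have "closed {q :: complex ^ 2. exp (- a) \<le> (cmod (q $ 2))\<^sup>2}"
    by (intro closed_Collect_le continuous_intros)
  ultimately have "exp (- a) \<le> (cmod (p $ 2))\<^sup>2"
    using p closure_minimal by blast
  then have nz: "p $ 2 \<noteq> 0" by (auto simp: not_le)
  have "worm_fun \<phi> p \<le> 0"
  proof (rule ccontr)
    assume "\<not> worm_fun \<phi> p \<le> 0"
    have "open ({p. p $ 2 \<noteq> 0} \<inter> worm_fun \<phi> -` {0<..})"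
      by (rule continuous_open_preimage[OF smooth_on_imp_continuous_on[OF smooth_on_worm_fun[OF assms(1)]] open_nonzero_snd])
        simp
    moreover have "({p. p $ 2 \<noteq> 0} \<inter> worm_fun \<phi> -` {0<..}) \<inter> worm_domain \<phi> = {}"
      by (auto simp: worm_domain_eq)
    ultimately show False
      using p nz \<open>\<not> worm_fun \<phi> p \<le> 0\<close> open_Int_closure_eq_empty by fastforce
  qed
  with nz show "p \<in> {p. p $ 2 \<noteq> 0 \<and> worm_fun \<phi> p \<le> 0}" by blast
next
  fix p assume "p \<in> {p. p $ 2 \<noteq> 0 \<and> worm_fun \<phi> p \<le> 0}"
  then have p: "p $ 2 \<noteq> 0" "worm_fun \<phi> p \<le> 0" by auto
  show "p \<in> closure (worm_domain \<phi>)"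
  proof (rule ccontr)
    assume np: "p \<notin> closure (worm_domain \<phi>)"
    have "p \<notin> worm_domain \<phi>" using np closure_subset by blast
    with p have 0: "worm_fun \<phi> p = 0" by (auto simp: worm_domain_eq)
    define N where "N = - closure (worm_domain \<phi>) \<inter> {p. p $ 2 \<noteq> 0}"
    have N: "open N" "p \<in> N" using np p open_nonzero_snd by (auto simp: N_def)
    have ge: "worm_fun \<phi> p \<le> worm_fun \<phi> q" if "q \<in> N" for q
    proof -
      have "q \<notin> worm_domain \<phi>" using that closure_subset by (auto simp: N_def)
      then show ?thesis using that 0 by (auto simp: N_def worm_domain_eq)
    qed
    have "(worm_fun \<phi> has_derivative frechet_derivative (worm_fun \<phi>) (at p)) (at p)"
      using smooth_on_differentiable[OF smooth_on_worm_fun[OF assms(1)], of p] p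
      by (simp add: frechet_derivative_works)
    then have "frechet_derivative (worm_fun \<phi>) (at p) = (\<lambda>v. 0)"
      by (rule differential_zero_maxmin[OF N(2,1)]) (use ge in blast)
    with frechet_derivative_worm_fun_nonzero[OF assms(1,2) p(1) 0] show False by blast
  qed
qed

lemma frontier_worm_domain:
  assumes "smooth_on UNIV \<phi>" "\<forall>x. \<phi> x = 1 \<longrightarrow> deriv \<phi> x \<noteq> 0"
    and "\<forall>x. x < - a \<or> x > a \<longrightarrow> \<phi> x > 1"
  shows "frontier (worm_domain \<phi>) = {p. p $ 2 \<noteq> 0 \<and> worm_fun \<phi> p = 0}"
proof -
  have "interior (worm_domain \<phi>) = worm_domain \<phi>"
    using open_worm_domain[OF assms(1)] by (simp add: interior_open)
  then have "frontier (worm_domain \<phi>) = {p. p $ 2 \<noteq> 0 \<and> worm_fun \<phi> p \<le> 0} - {p. p $ 2 \<noteq> 0 \<and> worm_fun \<phi> p < 0}"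
    unfolding frontier_def closure_worm_domain[OF assms] by (simp only: worm_domain_eq)
  then show ?thesis by force
qed

subsection \<open>The upper bound\<close>

text \<open>Along the imaginary axis a holomorphic curve has velocity multiplied by
  \<open>\<i>\<close> and acceleration multiplied by \<open>\<i> * \<i> = - 1\<close>, exactly what
  \<open>Re_levi_form_laplacian\<close> asks for.\<close>

lemma levi_form_along_holomorphic_curve:
  fixes f :: "complex ^ 2 \<Rightarrow> real"
  assumes "open S" "higher_differentiable_on S f 2" "pair_vec (g 0) (h 0) \<in> S"
    and g: "\<And>x. (g has_field_derivative g' x) (at x)" "(g' has_field_derivative g2) (at 0)"
    and h: "\<And>x. (h has_field_derivative h' x) (at x)" "(h' has_field_derivative h2) (at 0)"
  shows "\<exists>a b. has_second_derivative (\<lambda>t. f (pair_vec (g (of_real t)) (h (of_real t)))) a 0 \<and>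
    has_second_derivative (\<lambda>t. f (pair_vec (g (of_real t * \<i>)) (h (of_real t * \<i>)))) b 0 \<and>
    a + b = 4 * Re (levi_form f (pair_vec (g 0) (h 0)) (pair_vec (g' 0) (h' 0)))"
proof -
  have 1: "((\<lambda>t. pair_vec (g (of_real t * e)) (h (of_real t * e))) has_vector_derivative
      pair_vec (e * g' (of_real t * e)) (e * h' (of_real t * e))) (at t)" for e t
    by (intro pair_vec_has_vector_derivative has_vector_derivative_complex_line g(1) h(1))
  have 2: "((\<lambda>t. pair_vec (e * g' (of_real t * e)) (e * h' (of_real t * e))) has_vector_derivative
      pair_vec (e * (e * g2)) (e * (e * h2))) (at 0)" for e
    using g(2) h(2)
    by (intro pair_vec_has_vector_derivative has_vector_derivative_mult_right has_vector_derivative_complex_line) auto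
  have neg: "pair_vec (\<i> * (\<i> * g2)) (\<i> * (\<i> * h2)) = - pair_vec (1 * (1 * g2)) (1 * (1 * h2))"
    by (simp add: vec_eq_iff forall_2)
  show ?thesis
    using Re_levi_form_laplacian[OF assms(1-3) _ 1[of 1] 2[of 1] _ 1[of "\<i>"] 2[of "\<i>", unfolded neg],
        of "pair_vec (g' 0) (h' 0)"]
    by (simp add: scale_pair_vec)
qed

text \<open>Completing the square in \<open>R' 0\<close> is what produces the constant \<open>\<eta> / (\<eta> - 1)\<close>.\<close>

lemma has_second_derivative_weighted_powr:
  assumes R: "\<And>t. (R has_real_derivative R' t) (at t)" "(R' has_real_derivative R2) (at 0)"
    and u: "\<And>t. (u has_real_derivative u' t) (at t)" "(u' has_real_derivative u2) (at 0)"
    and "R 0 > 0" "\<eta> > 1"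
  shows "has_second_derivative (\<lambda>t. (R t * exp (u t)) powr \<eta>)
    ((R 0 * exp (u 0)) powr \<eta> * \<eta> / (R 0)\<^sup>2 *
     ((\<eta> - 1) * (R' 0 + \<eta> / (\<eta> - 1) * R 0 * u' 0)\<^sup>2 + R 0 * R2 + (R 0)\<^sup>2 * (u2 - \<eta> / (\<eta> - 1) * (u' 0)\<^sup>2))) 0"
proof -
  have contR: "continuous_on UNIV R"
    using R(1) DERIV_isCont continuous_at_imp_continuous_on by blast
  define T where "T = R -` {0<..}"
  have T: "open T" "0 \<in> T"
    using open_vimage[OF open_greaterThan contR] assms(5) by (auto simp: T_def)
  \<comment> \<open>\<open>L\<close> is the logarithmic derivative of \<open>R * exp u\<close>; the
    power is handled as \<open>exp (\<eta> * (u + ln R))\<close>.\<close>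
  define L where "L t = u' t + R' t / R t" for t
  have eq: "(R t * exp (u t)) powr \<eta> = exp (\<eta> * (u t + ln (R t)))" if "t \<in> T" for t
    using that by (simp add: T_def powr_def ln_mult)
  have d1: "((\<lambda>t. exp (\<eta> * (u t + ln (R t)))) has_real_derivative
      exp (\<eta> * (u t + ln (R t))) * (\<eta> * L t)) (at t)" if "t \<in> T" for t
    using that by (auto intro!: derivative_eq_intros R u simp: T_def L_def)
  have dL: "(L has_real_derivative u2 + (R2 * R 0 - R' 0 * R' 0) / (R 0)\<^sup>2) (at 0)"
    unfolding L_def[abs_def] using assms(5) by (auto intro!: derivative_eq_intros R u simp: power2_eq_square)
  have d2: "((\<lambda>t. exp (\<eta> * (u t + ln (R t))) * (\<eta> * L t)) has_real_derivative
      exp (\<eta> * (u 0 + ln (R 0))) * (\<eta> * (\<eta> * (L 0)\<^sup>2 + (u2 + (R2 * R 0 - R' 0 * R' 0) / (R 0)\<^sup>2)))) (at 0)"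
    by (rule DERIV_cong[OF DERIV_mult[OF d1[OF T(2)] DERIV_cmult[OF dL]]]) (simp add: algebra_simps power2_eq_square)
  have alg: "\<eta> * (\<eta> * (L 0)\<^sup>2 + (u2 + (R2 * R 0 - R' 0 * R' 0) / (R 0)\<^sup>2)) =
     \<eta> / (R 0)\<^sup>2 * ((\<eta> - 1) * (R' 0 + \<eta> / (\<eta> - 1) * R 0 * u' 0)\<^sup>2 + R 0 * R2 + (R 0)\<^sup>2 * (u2 - \<eta> / (\<eta> - 1) * (u' 0)\<^sup>2))"
  proof -
    \<comment> \<open>With \<open>k * y = y + 1\<close> the identity becomes polynomial; the
      remainder after completing the square has coefficient \<open>k * y + k - k * (k * y)\<close>,
      which is zero.\<close>
    define x y k where "x = R 0" and "y = \<eta> - 1" and "k = \<eta> / (\<eta> - 1)"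
    have x: "x > 0" and y: "y > 0" and ky: "k * y = y + 1" and e: "\<eta> = y + 1"
      using assms(5,6) by (auto simp: x_def y_def k_def)
    have "x\<^sup>2 * (\<eta> * (L 0)\<^sup>2 + (u2 + (R2 * x - R' 0 * R' 0) / x\<^sup>2)) = \<eta> * (x * L 0)\<^sup>2 + x\<^sup>2 * u2 + (R2 * x - (R' 0)\<^sup>2)"
      using x by (simp add: field_simps power2_eq_square)
    also have "x * L 0 = x * u' 0 + R' 0"
      using x by (simp add: L_def x_def field_simps)
    also have "\<eta> * (x * u' 0 + R' 0)\<^sup>2 + x\<^sup>2 * u2 + (R2 * x - (R' 0)\<^sup>2)
      = y * (R' 0)\<^sup>2 + 2 * (k * y) * (x * u' 0) * R' 0 + (k * y) * (x * u' 0)\<^sup>2 + x * R2 + x\<^sup>2 * u2"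
      unfolding ky e by (simp add: power2_eq_square algebra_simps)
    also have "\<dots> = y * (R' 0 + k * x * u' 0)\<^sup>2 + x * R2 + x\<^sup>2 * (u2 - k * (u' 0)\<^sup>2) + (k * y + k - k * (k * y)) * (x * u' 0)\<^sup>2"
      by (simp add: power2_eq_square algebra_simps)
    also have "k * y + k - k * (k * y) = 0"
      unfolding ky using ky by (simp add: algebra_simps)
    finally have "x\<^sup>2 * (\<eta> * (L 0)\<^sup>2 + (u2 + (R2 * x - R' 0 * R' 0) / x\<^sup>2))
      = y * (R' 0 + k * x * u' 0)\<^sup>2 + x * R2 + x\<^sup>2 * (u2 - k * (u' 0)\<^sup>2)" by simp
    then have "\<eta> * (L 0)\<^sup>2 + (u2 + (R2 * x - R' 0 * R' 0) / x\<^sup>2)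
      = (y * (R' 0 + k * x * u' 0)\<^sup>2 + x * R2 + x\<^sup>2 * (u2 - k * (u' 0)\<^sup>2)) / x\<^sup>2"
      using x by (metis nonzero_mult_div_cancel_left power_not_zero less_irrefl)
    then show ?thesis unfolding x_def y_def k_def by simp
  qed
  have "has_second_derivative (\<lambda>t. exp (\<eta> * (u t + ln (R t))))
      (exp (\<eta> * (u 0 + ln (R 0))) * (\<eta> * (\<eta> * (L 0)\<^sup>2 + (u2 + (R2 * R 0 - R' 0 * R' 0) / (R 0)\<^sup>2)))) 0"
    by (rule has_second_derivativeI[OF T d1 d2])
  moreover have "\<forall>\<^sub>F t in nhds 0. exp (\<eta> * (u t + ln (R t))) = (R t * exp (u t)) powr \<eta>"
    using eventually_nhds_in_open[OF T] by eventually_elim (simp add: eq)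
  ultimately have "has_second_derivative (\<lambda>t. (R t * exp (u t)) powr \<eta>)
      (exp (\<eta> * (u 0 + ln (R 0))) * (\<eta> * (\<eta> * (L 0)\<^sup>2 + (u2 + (R2 * R 0 - R' 0 * R' 0) / (R 0)\<^sup>2)))) 0"
    by (rule has_second_derivative_cong)
  then show ?thesis unfolding alg eq[OF T(2), symmetric] by (simp add: mult.assoc)
qed

text \<open>
  The factor \<open>exp (\<i> * (a * x))\<close> in the first component makes \<open>exp (2 * Im (a * x))\<close> times the defining
  function a sum of a square modulus, a pluriharmonic term and a profile term, hence plurisubharmonic.
\<close>

lemma worm_fun_along_curve:
  assumes "w \<noteq> 0"
  defines "s \<equiv> ln ((cmod w)\<^sup>2)"
  shows "worm_fun \<phi> (pair_vec ((z + c * x) * exp (\<i> * (a * x))) (w * exp (a * x)))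
    = ((cmod (z + c * x))\<^sup>2 - 2 * Re ((z + c * x) * exp (- \<i> * (of_real s + a * x)))
       + \<phi> (s + 2 * Re (a * x)) * exp (2 * Im (a * x))) * exp (- (2 * Im (a * x)))"
proof -
  define b where "b = a * x"
  define y where "y = z + c * x"
  have s: "ln ((cmod (w * exp b))\<^sup>2) = s + 2 * Re b"
    using ln_cmod_exp[OF assms(1)] by (simp add: s_def)
  have 1: "(cmod (y * exp (\<i> * b)))\<^sup>2 = (cmod y)\<^sup>2 * exp (- (2 * Im b))"
    by (simp add: norm_mult power_mult_distrib flip: exp_double)
  have "Re (y * exp (\<i> * b)) * cos (s + 2 * Re b) + Im (y * exp (\<i> * b)) * sin (s + 2 * Re b)
      = Re (y * exp (\<i> * b) * cis (- (s + 2 * Re b)))"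
    by (simp add: cos_minus sin_minus del: minus_add_distrib)
  also have "y * exp (\<i> * b) * cis (- (s + 2 * Re b)) = y * (exp (\<i> * b) * exp (\<i> * of_real (- (s + 2 * Re b))))"
    by (simp only: cis_conv_exp mult.assoc)
  \<comment> \<open>\<open>2 * Re b - b\<close> is the conjugate of \<open>b\<close>; replacing it
    by \<open>b\<close> restores holomorphy at the cost of the real factor
    \<open>exp (- (2 * Im b))\<close>.\<close>
  also have "exp (\<i> * b) * exp (\<i> * of_real (- (s + 2 * Re b))) = exp (- \<i> * (of_real s + b)) * exp (of_real (- (2 * Im b)))"
    unfolding exp_add[symmetric] by (intro arg_cong[of _ _ exp]) (simp add: complex_eq_iff)
  also have "Re (y * (exp (- \<i> * (of_real s + b)) * exp (of_real (- (2 * Im b)))))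
    = Re (y * exp (- \<i> * (of_real s + b))) * exp (- (2 * Im b))"
    unfolding exp_of_real mult.assoc[symmetric] by simp
  finally have 2: "Re (y * exp (\<i> * b)) * cos (s + 2 * Re b) + Im (y * exp (\<i> * b)) * sin (s + 2 * Re b)
    = Re (y * exp (- \<i> * (of_real s + b))) * exp (- (2 * Im b))" .
  have 3: "\<phi> (s + 2 * Re b) = \<phi> (s + 2 * Re b) * exp (2 * Im b) * exp (- (2 * Im b))"
    by (simp add: mult.assoc flip: exp_add)
  show ?thesis
    unfolding b_def[symmetric] y_def[symmetric] worm_fun_def pair_vec_nth s 1 2
    by (subst 3) (simp only: left_diff_distrib distrib_right mult.assoc)
qed

text \<open>
  Along the curve of \<open>worm_fun_along_curve\<close> the function is \<open>(R * exp v) powr \<eta>\<close>; by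
  \<open>has_second_derivative_weighted_powr\<close> its Laplacian is, up to a positive factor, a sum of squares plus
  \<open>R * \<Delta>R + R\<^sup>2 * (\<Delta>v - \<eta> / (\<eta> - 1) * |\<nabla>v|\<^sup>2)\<close>.
\<close>

lemma levi_form_worm_powr_pos:
  assumes \<phi>: "smooth_on UNIV \<phi>" "\<And>x. 0 \<le> deriv (deriv \<phi>) x" and u: "smooth_on UNIV u" and "\<eta> > 1"
    and S: "open S" "higher_differentiable_on S f 2" "p \<in> S"
    and f: "f = (\<lambda>p. (worm_fun \<phi> p * exp (u (ln ((cmod (p $ 2))\<^sup>2)))) powr \<eta>)"
    and p: "p $ 2 \<noteq> 0" "0 < worm_fun \<phi> p"
  defines "s \<equiv> ln ((cmod (p $ 2))\<^sup>2)"
  assumes pos: "0 < \<phi> s + worm_fun \<phi> p * (deriv (deriv u) s - \<eta> / (\<eta> - 1) * (1 + (deriv u s)\<^sup>2))"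
    and "t \<noteq> 0"
  shows "0 < Re (levi_form f p t)"
proof -
  \<comment> \<open>\<open>a\<close> and \<open>c\<close> are chosen so that the curve
    \<open>(g, h)\<close> passes through \<open>p\<close> with velocity \<open>t\<close> at
    0.\<close>
  define z w a c where "z = p $ 1" and "w = p $ 2" and "a = t $ 2 / p $ 2" and "c = t $ 1 - \<i> * a * p $ 1"
  define k where "k = \<eta> / (\<eta> - 1)"
  have w: "w \<noteq> 0" and pzw: "pair_vec z w = p" using p by (auto simp: z_def w_def)
  have sw: "ln ((cmod w)\<^sup>2) = s" by (simp add: s_def w_def)
  define g where "g x = (z + c * x) * exp (\<i> * (a * x))" for x
  define h where "h x = w * exp (a * x)" for x
  define q where "q x = (z + c * x) * exp (- \<i> * (of_real s + a * x))" for x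
  define q' where "q' x = c * exp (- \<i> * (of_real s + a * x)) + (z + c * x) * (exp (- \<i> * (of_real s + a * x)) * (- \<i> * a))" for x
  have g: "(g has_field_derivative (c * exp (\<i> * (a * x)) + (z + c * x) * (exp (\<i> * (a * x)) * (\<i> * a)))) (at x)" for x
    unfolding g_def[abs_def] by (auto intro!: derivative_eq_intros)
  have h: "(h has_field_derivative w * (exp (a * x) * a)) (at x)" for x
    unfolding h_def[abs_def] by (auto intro!: derivative_eq_intros)
  have q: "(q has_field_derivative q' x) (at x)" for x
    unfolding q_def[abs_def] q'_def by (auto intro!: derivative_eq_intros)
  have g': "\<exists>D. ((\<lambda>x. c * exp (\<i> * (a * x)) + (z + c * x) * (exp (\<i> * (a * x)) * (\<i> * a))) has_field_derivative D) (at 0)"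
    by (rule exI) (auto intro!: derivative_eq_intros)
  have h': "\<exists>D. ((\<lambda>x. w * (exp (a * x) * a)) has_field_derivative D) (at 0)"
    by (rule exI) (auto intro!: derivative_eq_intros)
  \<comment> \<open>The value can stay implicit: it enters the directions \<open>1\<close> and
    \<open>\<i>\<close> with opposite signs and cancels in the Laplacian.\<close>
  have q2: "\<exists>D. (q' has_field_derivative D) (at 0)"
    unfolding q'_def[abs_def] by (rule exI) (auto intro!: derivative_eq_intros)
  obtain g2 where g2: "((\<lambda>x. c * exp (\<i> * (a * x)) + (z + c * x) * (exp (\<i> * (a * x)) * (\<i> * a))) has_field_derivative g2) (at 0)"
    using g' by blast
  obtain h2 where h2: "((\<lambda>x. w * (exp (a * x) * a)) has_field_derivative h2) (at 0)"
    using h' by blast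
  obtain q2 where q2: "(q' has_field_derivative q2) (at 0)" using q2 by blast
  have S0: "pair_vec (g 0) (h 0) \<in> S" using S(3) pzw by (simp add: g_def h_def)
  obtain A B where AB: "has_second_derivative (\<lambda>t. f (pair_vec (g (of_real t)) (h (of_real t)))) A 0"
      "has_second_derivative (\<lambda>t. f (pair_vec (g (of_real t * \<i>)) (h (of_real t * \<i>)))) B 0"
      "A + B = 4 * Re (levi_form f (pair_vec (g 0) (h 0))
         (pair_vec (c * exp (\<i> * (a * 0)) + (z + c * 0) * (exp (\<i> * (a * 0)) * (\<i> * a))) (w * (exp (a * 0) * a))))"
    using levi_form_along_holomorphic_curve[OF S(1,2) S0 g g2 h h2] by blast
  have "pair_vec (c * exp (\<i> * (a * 0)) + (z + c * 0) * (exp (\<i> * (a * 0)) * (\<i> * a))) (w * (exp (a * 0) * a)) = t"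
    using w by (simp add: vec_eq_iff forall_2 c_def a_def z_def w_def)
  with AB(3) pzw have AB3: "A + B = 4 * Re (levi_form f p t)" by (simp add: g_def h_def)
  \<comment> \<open>\<open>R e\<close> is the worm function along the real line in direction
    \<open>e\<close> of unit length, multiplied by \<open>exp (2 * Im (a * e) * t)\<close>; the term
    \<open>- 2 * Im (a * e) * t\<close> in \<open>v\<close> below undoes this factor.\<close>
  define R where "R e t = (cmod z)\<^sup>2 + 2 * Re (cnj z * (c * e)) * t + (cmod c)\<^sup>2 * t\<^sup>2 - 2 * Re (q (of_real t * e))
      + \<phi> (s + 2 * Re (a * e) * t) * exp (2 * Im (a * e) * t)" for e t
  define R' where "R' e t = 2 * Re (cnj z * (c * e)) + 2 * (cmod c)\<^sup>2 * t - 2 * Re (e * q' (of_real t * e))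
      + (deriv \<phi> (s + 2 * Re (a * e) * t) * (2 * Re (a * e)) * exp (2 * Im (a * e) * t)
       + \<phi> (s + 2 * Re (a * e) * t) * (exp (2 * Im (a * e) * t) * (2 * Im (a * e))))" for e t
  define v where "v e t = u (s + 2 * Re (a * e) * t) - 2 * Im (a * e) * t" for e t
  have lin: "((\<lambda>t. s + y * t) has_real_derivative y) (at t)" for y t :: real
    by (auto intro!: derivative_eq_intros)
  have Req: "((\<lambda>t. Re (G (of_real t * e))) has_real_derivative Re (e * G')) (at t)"
    if "(G has_field_derivative G') (at (of_real t * e))" for G G' e t
    using bounded_linear.has_vector_derivative[OF bounded_linear_Re has_vector_derivative_complex_line[OF that]]
    by (simp add: has_real_derivative_iff_has_vector_derivative)
  have dR: "(R e has_real_derivative R' e t) (at t)" for e t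
    unfolding R_def[abs_def] R'_def
    by (rule derivative_eq_intros refl Req[OF q] smooth_real_chain[OF \<phi>(1) lin] | simp)+
  have dR': "(R' e has_real_derivative 2 * (cmod c)\<^sup>2 - 2 * Re (e * (e * q2))
      + (deriv (deriv \<phi>) s * (2 * Re (a * e))\<^sup>2 + 2 * deriv \<phi> s * (2 * Re (a * e)) * (2 * Im (a * e))
        + \<phi> s * (2 * Im (a * e))\<^sup>2)) (at 0)" for e
  proof -
    have 1: "((\<lambda>x. e * q' x) has_field_derivative e * q2) (at (of_real 0 * e))"
      using q2 by (auto intro!: derivative_eq_intros)
    show ?thesis
      unfolding R'_def[abs_def]
      by (rule derivative_eq_intros refl Req[OF 1] smooth_real_chain[OF \<phi>(1) lin]
          smooth_real_chain[OF smooth_on_deriv(2)[OF \<phi>(1)] lin] | (simp add: power2_eq_square algebra_simps))+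
  qed
  have dv: "(v e has_real_derivative deriv u (s + 2 * Re (a * e) * t) * (2 * Re (a * e)) - 2 * Im (a * e)) (at t)" for e t
    unfolding v_def[abs_def]
    by (rule derivative_eq_intros refl smooth_real_chain[OF u lin] | simp)+
  have dv': "((\<lambda>t. deriv u (s + 2 * Re (a * e) * t) * (2 * Re (a * e)) - 2 * Im (a * e)) has_real_derivative
      deriv (deriv u) s * (2 * Re (a * e))\<^sup>2) (at 0)" for e
    by (rule derivative_eq_intros refl smooth_real_chain[OF smooth_on_deriv(2)[OF u] lin] | (simp add: power2_eq_square))+
  have curve: "f (pair_vec (g (of_real t * e)) (h (of_real t * e))) = (R e t * exp (v e t)) powr \<eta>" if "cmod e = 1" for e t
  proof -
    have 1: "ln ((cmod (h (of_real t * e)))\<^sup>2) = s + 2 * Re (a * e) * t"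
      unfolding h_def ln_cmod_exp[OF w] by (simp add: s_def w_def algebra_simps)
    have "(cmod (z + c * (of_real t * e)))\<^sup>2 = (cmod z)\<^sup>2 + 2 * Re (cnj z * (c * e)) * t + (cmod (c * e))\<^sup>2 * t\<^sup>2"
      unfolding cmod_power2 by (simp add: power2_eq_square algebra_simps)
    then have 2: "(cmod (z + c * (of_real t * e)))\<^sup>2 = (cmod z)\<^sup>2 + 2 * Re (cnj z * (c * e)) * t + (cmod c)\<^sup>2 * t\<^sup>2"
      using that by (simp add: norm_mult)
    have 3: "2 * Re (a * (of_real t * e)) = 2 * Re (a * e) * t" "2 * Im (a * (of_real t * e)) = 2 * Im (a * e) * t"
      by (simp_all add: algebra_simps)
    have "worm_fun \<phi> (pair_vec (g (of_real t * e)) (h (of_real t * e))) = R e t * exp (- (2 * Im (a * e) * t))"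
      unfolding g_def h_def worm_fun_along_curve[OF w] R_def q_def sw 2 3 ..
    moreover have "exp (- (2 * Im (a * e) * t)) * exp (u (s + 2 * Re (a * e) * t)) = exp (v e t)"
      by (simp add: v_def flip: exp_add)
    ultimately show ?thesis
      unfolding f pair_vec_nth 1 by (simp only: mult.assoc)
  qed
  have R0: "R e 0 = worm_fun \<phi> p" if "cmod e = 1" for e
    using worm_fun_along_curve[OF w, of \<phi> z c 0 a] pzw by (simp add: R_def q_def w_def s_def)
  define F where "F = (worm_fun \<phi> p * exp (u s)) powr \<eta> * \<eta> / (worm_fun \<phi> p)\<^sup>2"
  have F: "F > 0" using p assms(4) by (simp add: F_def)
  \<comment> \<open>The completed square, of which only nonnegativity is used.\<close>
  define X where "X e = (\<eta> - 1) * (R' e 0 + k * worm_fun \<phi> p * (deriv u s * (2 * Re (a * e)) - 2 * Im (a * e)))\<^sup>2" for e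
  have hsd: "has_second_derivative (\<lambda>t. f (pair_vec (g (of_real t * e)) (h (of_real t * e))))
     (F * (X e + worm_fun \<phi> p * (2 * (cmod c)\<^sup>2 - 2 * Re (e * (e * q2))
      + (deriv (deriv \<phi>) s * (2 * Re (a * e))\<^sup>2 + 2 * deriv \<phi> s * (2 * Re (a * e)) * (2 * Im (a * e))
        + \<phi> s * (2 * Im (a * e))\<^sup>2)) + (worm_fun \<phi> p)\<^sup>2 *
       (deriv (deriv u) s * (2 * Re (a * e))\<^sup>2 - k * (deriv u s * (2 * Re (a * e)) - 2 * Im (a * e))\<^sup>2))) 0"
    if e: "cmod e = 1" for e
  proof -
    have R0': "R e 0 > 0" using R0[OF e] p by simp
    have v0: "v e 0 = u s" by (simp add: v_def)
    show ?thesis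
      using has_second_derivative_weighted_powr[OF dR[of e] dR'[of e] dv[of e] dv'[of e] R0' assms(4)]
      unfolding curve[OF e] R0[OF e] v0 X_def F_def k_def by simp
  qed
  have A: "A = F * (X 1 + worm_fun \<phi> p * (2 * (cmod c)\<^sup>2 - 2 * Re q2
      + (deriv (deriv \<phi>) s * (2 * Re a)\<^sup>2 + 2 * deriv \<phi> s * (2 * Re a) * (2 * Im a)
        + \<phi> s * (2 * Im a)\<^sup>2)) + (worm_fun \<phi> p)\<^sup>2 *
       (deriv (deriv u) s * (2 * Re a)\<^sup>2 - k * (deriv u s * (2 * Re a) - 2 * Im a)\<^sup>2))"
    using has_second_derivative_unique[OF AB(1)] hsd[of 1] by simp
  have B: "B = F * (X \<i> + worm_fun \<phi> p * (2 * (cmod c)\<^sup>2 + 2 * Re q2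
      + (deriv (deriv \<phi>) s * (2 * Im a)\<^sup>2 - 2 * deriv \<phi> s * (2 * Im a) * (2 * Re a)
        + \<phi> s * (2 * Re a)\<^sup>2)) + (worm_fun \<phi> p)\<^sup>2 *
       (deriv (deriv u) s * (2 * Im a)\<^sup>2 - k * (- deriv u s * (2 * Im a) - 2 * Re a)\<^sup>2))"
    using has_second_derivative_unique[OF AB(2)] hsd[of "\<i>"] by simp
  \<comment> \<open>The terms in \<open>q2\<close> and the mixed terms in
    \<open>deriv \<phi>\<close> cancel, and the squares of \<open>Re a\<close> and
    \<open>Im a\<close> combine to \<open>|a|^2\<close>; the twist in \<open>v\<close> produces the
    \<open>1\<close> in \<open>1 + (deriv u s)^2\<close>.\<close>
  have "A + B = F * (X 1 + X \<i> + 4 * worm_fun \<phi> p * ((cmod c)\<^sup>2 + (cmod a)\<^sup>2 * (deriv (deriv \<phi>) s +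
     (\<phi> s + worm_fun \<phi> p * (deriv (deriv u) s - k * (1 + (deriv u s)\<^sup>2))))))"
    unfolding A B cmod_power2[of a] by (simp add: power2_eq_square algebra_simps)
  moreover have "0 < (cmod c)\<^sup>2 + (cmod a)\<^sup>2 * (deriv (deriv \<phi>) s +
     (\<phi> s + worm_fun \<phi> p * (deriv (deriv u) s - k * (1 + (deriv u s)\<^sup>2))))" (is "0 < _ + _ * ?Q")
  proof -
    have Q: "?Q > 0" using \<phi>(2)[of s] pos by (simp add: k_def)
    show ?thesis
    proof (cases "a = 0")
      case True
      with w have "t $ 2 = 0" by (simp add: a_def w_def)
      then have "t $ 1 \<noteq> 0" using \<open>t \<noteq> 0\<close> by (auto simp: vec_eq_iff forall_2)
      then show ?thesis using True by (simp add: c_def)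
    next
      case False
      then have "0 < (cmod a)\<^sup>2 * ?Q" using Q by simp
      then show ?thesis by (simp add: add_nonneg_pos)
    qed
  qed
  moreover have "X e \<ge> 0" for e using assms(4) by (simp add: X_def)
  ultimately have "A + B > 0"
    using F p(2) by (simp add: add_nonneg_pos)
  then show ?thesis using AB3 by simp
qed

section \<open>Convexity of the profile and construction of the weight\<close>

text \<open>Adding the tangent inequalities at two points shows that \<open>deriv f\<close> is
  increasing.\<close>

lemma convex_on_imp_second_deriv_nonneg:
  assumes "convex_on UNIV f" "smooth_on UNIV f"
  shows "0 \<le> deriv (deriv f) x"
proof (rule ccontr)
  assume "\<not> 0 \<le> deriv (deriv f) x"
  then obtain d where d: "d > 0" "\<And>h. 0 < h \<Longrightarrow> h < d \<Longrightarrow> deriv f (x + h) < deriv f x"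
    using DERIV_neg_dec_right[OF smooth_on_deriv(1)[OF smooth_on_deriv(2)[OF assms(2)]], of x] by auto
  have tangent: "deriv f x * (y - x) \<le> f y - f x" for x y
    by (rule convex_on_imp_above_tangent[OF assms(1)]) (use smooth_on_deriv(1)[OF assms(2)] in auto)
  have "(deriv f (x + d / 2) - deriv f x) * (d / 2) \<ge> 0"
    using tangent[of x "x + d / 2"] tangent[of "x + d / 2" x] by (simp add: algebra_simps)
  then show False using d(1) d(2)[of "d / 2"] by (simp add: zero_le_mult_iff)
qed

text \<open>
  \<open>cos (l * s)\<close> with \<open>l > k\<close> solves the inequality where it is positive; a multiple of \<open>cosh (M * s)\<close>,
  negligible on \<open>[-b, b]\<close> for large \<open>M\<close>, makes it positive on the whole line.
\<close>

lemma exists_positive_weight: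
  assumes "0 < b" "0 < k" "k * b < pi / 2"
  obtains G G1 G2 :: "real \<Rightarrow> real"
  where "smooth_on UNIV G" "\<And>s. G s > 0" "\<And>s. (G has_real_derivative G1 s) (at s)"
    "\<And>s. (G1 has_real_derivative G2 s) (at s)" "\<And>s. \<bar>s\<bar> \<le> b \<Longrightarrow> G2 s + k\<^sup>2 * G s < 0"
proof -
  \<comment> \<open>\<open>l > k\<close> gives a strict inequality for \<open>cos (l * s)\<close>;
    \<open>l * b < pi / 2\<close> keeps it positive on the closed interval.\<close>
  obtain l where l: "k < l" "l < pi / (2 * b)"
    using dense[of k "pi / (2 * b)"] assms by (auto simp: field_simps)
  \<comment> \<open>The gap between \<open>b\<close> and \<open>b1\<close> is room for the
    \<open>cosh\<close> term: negligible up to \<open>b\<close>, dominant beyond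
    \<open>b1\<close>.\<close>
  obtain b1 where b1: "b < b1" "b1 < pi / (2 * l)"
    using dense[of b "pi / (2 * l)"] assms l by (auto simp: field_simps)
  have l0: "l > 0" using assms l by simp
  have lb: "l * b < pi / 2" and lb1: "l * b1 < pi / 2"
    using l b1 assms l0 by (auto simp: field_simps)
  define c where "c = (l\<^sup>2 - k\<^sup>2) * cos (l * b)"
  have cb: "cos (l * b) > 0" using lb l0 assms by (intro cos_gt_zero) auto
  have lk: "l\<^sup>2 - k\<^sup>2 > 0" using l assms by (simp add: power_strict_mono)
  have c: "c > 0" using cb lk by (simp add: c_def)
  \<comment> \<open>On \<open>[-b, b]\<close> the cosine contributes at most \<open>- c\<close> to
    \<open>G2 + k^2 * G\<close>, and the expression here bounds the contribution of
    \<open>e * cosh (M * s)\<close>.\<close>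
  have "((\<lambda>M. (M\<^sup>2 + k\<^sup>2) * 4 * exp (- (M * (b1 - b)))) \<longlongrightarrow> 0) at_top"
    using b1(1) by real_asymp
  then have "\<forall>\<^sub>F M in at_top. (M\<^sup>2 + k\<^sup>2) * 4 * exp (- (M * (b1 - b))) < c"
    using c order_tendstoD(2) by blast
  then obtain M where M: "M > 0" "(M\<^sup>2 + k\<^sup>2) * 4 * exp (- (M * (b1 - b))) < c"
    using eventually_happens[OF eventually_conj[OF eventually_gt_at_top[of 0]]] by auto
  \<comment> \<open>Normalised so that the \<open>cosh\<close> term equals 2 at \<open>b1\<close>
    and hence beats \<open>cos >= - 1\<close> beyond it.\<close>
  define e where "e = 2 / cosh (M * b1)"
  have e: "e > 0" by (simp add: e_def cosh_real_pos)
  define G where "G s = cos (l * s) + e * cosh (M * s)" for s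
  define G1 where "G1 s = - (l * sin (l * s)) + e * (M * sinh (M * s))" for s
  define G2 where "G2 s = - (l\<^sup>2 * cos (l * s)) + e * (M\<^sup>2 * cosh (M * s))" for s
  have "(G has_real_derivative G1 s) (at s)" "(G1 has_real_derivative G2 s) (at s)" for s
    unfolding G_def[abs_def] G1_def[abs_def] G2_def
    by (auto intro!: derivative_eq_intros simp: power2_eq_square)
  moreover have "smooth_on UNIV G"
  proof -
    have sm: "smooth_on UNIV (\<lambda>s::real. a * s)" for a
      by (rule smooth_on_bounded_linear[OF bounded_linear_mult_right])
    have "smooth_on UNIV (\<lambda>s. cos (l * s) + e * ((1 / 2) * (exp (M * s) + exp (- M * s))))"
      by (intro smooth_on_add smooth_on_mult smooth_on_const smooth_on_compose_real[OF smooth_on_sin_cos(2)]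
          smooth_on_compose_real[OF smooth_on_exp] sm) auto
    then show ?thesis by (simp add: G_def[abs_def] cosh_field_def)
  qed
  moreover have "G s > 0" for s
  proof (cases "\<bar>s\<bar> \<le> b1")
    case True
    then have "\<bar>l * s\<bar> < pi / 2" using lb1 l0
      by (metis abs_mult abs_of_pos le_less_trans mult_left_mono less_imp_le)
    then have "cos (l * s) > 0" by (intro cos_gt_zero_pi) auto
    then show ?thesis using e by (simp add: G_def add_pos_pos cosh_real_pos)
  next
    case False
    then have "\<bar>M * b1\<bar> \<le> \<bar>M * s\<bar>"
      using b1(1) assms(1) M(1) by (simp add: abs_mult mult_left_mono)
    then have "cosh (M * b1) \<le> cosh (M * s)"
      by (metis abs_ge_zero cosh_real_abs cosh_real_nonneg_le_iff)
    then have "2 \<le> e * cosh (M * s)"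
      using cosh_real_pos[of "M * b1"] by (simp add: e_def field_simps)
    then show ?thesis using cos_ge_minus_one[of "l * s"] unfolding G_def by linarith
  qed
  moreover have "G2 s + k\<^sup>2 * G s < 0" if "\<bar>s\<bar> \<le> b" for s
  proof -
    have "l * b \<le> pi" using lb pi_gt_zero by linarith
    then have "cos (l * b) \<le> cos \<bar>l * s\<bar>"
      using that l0 by (intro cos_monotone_0_pi_le) (auto simp: abs_mult mult_left_mono)
    then have 1: "(l\<^sup>2 - k\<^sup>2) * cos (l * s) \<ge> c"
      using lk by (simp add: c_def mult_left_mono)
    have "\<bar>M * s\<bar> \<le> \<bar>M * b\<bar>"
      using that M(1) by (simp add: abs_mult mult_left_mono)
    then have "cosh (M * s) \<le> cosh (M * b)"
      by (metis abs_ge_zero cosh_real_abs cosh_real_nonneg_le_iff)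
    also have "\<dots> \<le> exp (M * b)"
      using M(1) assms(1) by (simp add: cosh_field_def)
    finally have "cosh (M * s) \<le> exp (M * b)" .
    moreover have "e \<le> 4 * exp (- (M * b1))"
    proof -
      have "exp (M * b1) \<le> 2 * cosh (M * b1)" by (simp add: cosh_field_def)
      then have "2 / cosh (M * b1) \<le> 2 / (exp (M * b1) / 2)"
        by (intro divide_left_mono) (auto simp: cosh_real_pos)
      then show ?thesis by (simp add: e_def exp_minus inverse_eq_divide)
    qed
    ultimately have "e * cosh (M * s) \<le> 4 * exp (- (M * b1)) * exp (M * b)"
      using e by (intro mult_mono) auto
    also have "\<dots> = 4 * exp (- (M * (b1 - b)))"
      by (simp add: algebra_simps flip: exp_add)
    finally have "(M\<^sup>2 + k\<^sup>2) * (e * cosh (M * s)) \<le> (M\<^sup>2 + k\<^sup>2) * (4 * exp (- (M * (b1 - b))))"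
      by (intro mult_left_mono) auto
    then have "(M\<^sup>2 + k\<^sup>2) * (e * cosh (M * s)) < c"
      using M(2) unfolding mult.assoc by (rule le_less_trans)
    then show ?thesis using 1 by (simp add: G_def G2_def algebra_simps)
  qed
  ultimately show ?thesis using that by blast
qed

text \<open>The substitution \<open>u = - ln G / k\<close> linearises the Riccati inequality.\<close>

lemma exists_smooth_riccati_subsolution:
  assumes "0 < b" "0 < k" "k * b < pi / 2"
  obtains u :: "real \<Rightarrow> real"
  where "smooth_on UNIV u" "\<And>s. \<bar>s\<bar> \<le> b \<Longrightarrow> deriv (deriv u) s - k * (1 + (deriv u s)\<^sup>2) > 0"
proof -
  obtain G G1 G2 :: "real \<Rightarrow> real" where G: "smooth_on UNIV G" "\<And>s. G s > 0"
    "\<And>s. (G has_real_derivative G1 s) (at s)"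
    "\<And>s. (G1 has_real_derivative G2 s) (at s)" "\<And>s. \<bar>s\<bar> \<le> b \<Longrightarrow> G2 s + k\<^sup>2 * G s < 0"
    using exists_positive_weight[OF assms] by metis
  define u where "u s = (- 1 / k) * ln (G s)" for s
  have "smooth_on UNIV u"
    unfolding u_def[abs_def] using G(1,2)
    by (intro smooth_on_mult smooth_on_const smooth_on_compose_real[OF smooth_on_ln]) auto
  moreover have "deriv (deriv u) s - k * (1 + (deriv u s)\<^sup>2) > 0" if s: "\<bar>s\<bar> \<le> b" for s
  proof -
    have nz: "G s \<noteq> 0" for s using G(2)[of s] by simp
    have "(u has_real_derivative - (G1 s / (k * G s))) (at s)" for s
      unfolding u_def[abs_def] using G(2)[of s] assms(2)
      by (auto intro!: derivative_eq_intros G(3) simp: field_simps)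
    then have d1: "deriv u = (\<lambda>s. - (G1 s / (k * G s)))" by (auto intro: DERIV_imp_deriv)
    have "((\<lambda>s. - (G1 s / (k * G s))) has_real_derivative - ((G2 s * (k * G s) - G1 s * (k * G1 s)) / (k * G s * (k * G s)))) (at s)"
      using nz assms(2) by (intro DERIV_minus DERIV_divide DERIV_cmult G(3,4)) auto
    then have d2: "deriv (deriv u) s = - ((G2 s * (k * G s) - G1 s * (k * G1 s)) / (k * G s * (k * G s)))"
      unfolding d1 by (rule DERIV_imp_deriv)
    have "deriv (deriv u) s - k * (1 + (deriv u s)\<^sup>2) = - (G2 s + k\<^sup>2 * G s) / (k * G s)"
      unfolding d2 unfolding d1 using nz[of s] assms(2) by (simp add: field_simps power2_eq_square)
    then show ?thesis using G(2)[of s] G(5)[OF s] assms(2) by simp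
  qed
  ultimately show ?thesis using that by blast
qed

section \<open>Exponents above the threshold are realised\<close>

lemma steinness_index_worm_le:
  assumes "pi / 2 < \<beta>" "\<beta> < pi" "worm_profile \<beta> \<phi>" "\<eta> > pi / (2 * (pi - \<beta>))"
  shows "steinness_index (worm_domain \<phi>) \<le> ereal \<eta>"
proof -
  define b where "b = \<beta> - pi / 2"
  have b: "b > 0" using assms by (simp add: b_def)
  obtain a where \<phi>: "smooth_on UNIV \<phi>" "\<And>x. 0 \<le> \<phi> x" "convex_on UNIV \<phi>" "\<phi> -` {0} = {- b..b}"
      "\<forall>x. x < - a \<or> x > a \<longrightarrow> \<phi> x > 1" "\<forall>x. \<phi> x = 1 \<longrightarrow> deriv \<phi> x \<noteq> 0"
    using assms(3) unfolding worm_profile_def b_def by blast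
  note clos = closure_worm_domain[OF \<phi>(1,6,5)] and front = frontier_worm_domain[OF \<phi>(1,6,5)]
  have "1 < pi / (2 * (pi - \<beta>))" using assms by (simp add: field_simps)
  then have \<eta>: "\<eta> > 1" using assms(4) by simp
  define k where "k = \<eta> / (\<eta> - 1)"
  \<comment> \<open>The lower bound on \<open>\<eta>\<close> is rearranged into
    \<open>k * b < pi / 2\<close>, the condition under which the weight was constructed.\<close>
  have "pi / 2 < \<eta> * (pi - \<beta>)" using assms by (simp add: field_simps)
  then have "\<eta> * b < (\<eta> - 1) * (pi / 2)" by (simp add: b_def algebra_simps)
  then have kb: "k * b < pi / 2" and k: "0 < k" using \<eta> by (simp_all add: k_def field_simps)
  obtain u :: "real \<Rightarrow> real" where u: "smooth_on UNIV u"
      "\<And>s. \<bar>s\<bar> \<le> b \<Longrightarrow> deriv (deriv u) s - k * (1 + (deriv u s)\<^sup>2) > 0"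
    using exists_smooth_riccati_subsolution[OF b k kb] by metis
  define E where "E s = deriv (deriv u) s - k * (1 + (deriv u s)\<^sup>2)" for s
  define V where "V = {p :: complex ^ 2. p $ 2 \<noteq> 0}"
  define ls where "ls p = ln ((cmod (p $ 2))\<^sup>2)" for p :: "complex ^ 2"
  define r where "r = worm_fun \<phi>"
  define \<rho> where "\<rho> p = r p * exp (u (ls p))" for p
  have V: "open V" unfolding V_def by (rule open_nonzero_snd)
  have sm_ls: "smooth_on V ls" unfolding V_def ls_def[abs_def] by (rule smooth_on_ln_cmod_snd)
  have sm_r: "smooth_on V r" unfolding V_def r_def by (rule smooth_on_worm_fun[OF \<phi>(1)])
  have sm_e: "smooth_on V (\<lambda>p. exp (u (ls p)))"
    by (intro smooth_on_compose_real[OF smooth_on_exp] smooth_on_compose_real[OF u(1)] V sm_ls) auto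
  have sm: "smooth_on V \<rho>"
    unfolding \<rho>_def[abs_def] by (intro smooth_on_mult V sm_r sm_e)
  have def_fun: "defining_function (worm_domain \<phi>) V \<rho>"
    unfolding defining_function_def
  proof (intro conjI V sm ballI)
    show "closure (worm_domain \<phi>) \<subseteq> V" unfolding clos by (auto simp: V_def)
    show "worm_domain \<phi> = {z \<in> V. \<rho> z < 0}"
      by (auto simp: worm_domain_eq V_def \<rho>_def r_def mult_less_0_iff)
    fix p assume "p \<in> frontier (worm_domain \<phi>)"
    then have p: "p $ 2 \<noteq> 0" "r p = 0" "p \<in> V" unfolding front by (auto simp: r_def V_def)
    have "((\<lambda>p. r p * exp (u (ls p))) has_derivative
       (\<lambda>v. r p * frechet_derivative (\<lambda>p. exp (u (ls p))) (at p) v + frechet_derivative r (at p) v * exp (u (ls p)))) (at p)"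
      using smooth_on_differentiable[OF sm_r p(3)] smooth_on_differentiable[OF sm_e p(3)]
      by (intro has_derivative_mult) (simp_all add: frechet_derivative_works[symmetric])
    from fun_cong[OF frechet_derivative_at[OF this], symmetric]
    have D: "frechet_derivative \<rho> (at p) v = frechet_derivative r (at p) v * exp (u (ls p))" for v
      unfolding \<rho>_def[abs_def] using p(2) by simp
    show "frechet_derivative \<rho> (at p) \<noteq> (\<lambda>v. 0)"
    proof
      assume "frechet_derivative \<rho> (at p) = (\<lambda>v. 0)"
      then have "frechet_derivative r (at p) v = 0" for v using D[of v] by simp
      then show False
        using frechet_derivative_worm_fun_nonzero[OF \<phi>(1,6) p(1) p(2)[unfolded r_def]] unfolding r_def by blast
    qed
  qed
  \<comment> \<open>The first set covers the boundary where \<open>\<bar>s\<bar> \<le> b\<close>,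
    since there \<open>E > 0\<close>. The second covers the rest, where \<open>\<phi> > 0\<close>
    and \<open>r = 0\<close> on the boundary. Outside the closure \<open>r > 0\<close>, so either
    condition gives the positivity required by \<open>levi_form_worm_powr_pos\<close>.\<close>
  define U where "U = (V \<inter> (\<lambda>p. E (ls p)) -` {0<..}) \<union> (V \<inter> (\<lambda>p. \<phi> (ls p) + r p * E (ls p)) -` {0<..})"
  have contE: "continuous_on UNIV E"
    unfolding E_def[abs_def]
    using smooth_on_imp_continuous_on[OF smooth_on_deriv(2)[OF u(1)]]
      smooth_on_imp_continuous_on[OF smooth_on_deriv(2)[OF smooth_on_deriv(2)[OF u(1)]]]
    by (intro continuous_intros)
  have contls: "continuous_on V ls" by (rule smooth_on_imp_continuous_on[OF sm_ls])
  have contEls: "continuous_on V (\<lambda>p. E (ls p))"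
    by (rule continuous_on_compose2[OF contE contls]) auto
  have cont\<phi>ls: "continuous_on V (\<lambda>p. \<phi> (ls p))"
    by (rule continuous_on_compose2[OF smooth_on_imp_continuous_on[OF \<phi>(1)] contls]) auto
  have "open U"
    unfolding U_def
    by (intro open_Un continuous_open_preimage[OF _ V] contEls open_greaterThan
        continuous_on_add continuous_on_mult cont\<phi>ls smooth_on_imp_continuous_on[OF sm_r])
  moreover have "frontier (worm_domain \<phi>) \<subseteq> U"
  proof
    fix p assume "p \<in> frontier (worm_domain \<phi>)"
    then have p: "r p = 0" "p \<in> V" unfolding front by (auto simp: r_def V_def)
    show "p \<in> U"
    proof (cases "\<bar>ls p\<bar> \<le> b")
      case True
      then show ?thesis using u(2)[of "ls p"] p by (simp add: U_def E_def)
    next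
      case False
      then have "ls p \<notin> \<phi> -` {0}" unfolding \<phi>(4) by auto
      then have "\<phi> (ls p) > 0" using \<phi>(2)[of "ls p"] by simp
      then show ?thesis using p by (simp add: U_def)
    qed
  qed
  moreover have "U \<subseteq> V" by (auto simp: U_def)
  moreover have "strictly_plurisubharmonic_on (- closure (worm_domain \<phi>) \<inter> U) (\<lambda>z. \<rho> z powr \<eta>)"
  proof -
    define S where "S = - closure (worm_domain \<phi>) \<inter> U"
    have S: "open S" using \<open>open U\<close> by (auto simp: S_def)
    have SV: "S \<subseteq> V" using \<open>U \<subseteq> V\<close> by (auto simp: S_def)
    have rpos: "r p > 0" if "p \<in> S" for p
      using that SV unfolding S_def clos by (auto simp: V_def r_def)
    have "smooth_on S (\<lambda>z. \<rho> z powr \<eta>)"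
      by (rule smooth_on_powr[OF S smooth_on_subset[OF sm SV]]) (use rpos in \<open>simp add: \<rho>_def\<close>)
    then have hd: "higher_differentiable_on S (\<lambda>z. \<rho> z powr \<eta>) 2" unfolding smooth_on_def by blast
    have "0 < Re (levi_form (\<lambda>z. \<rho> z powr \<eta>) p t)" if p: "p \<in> S" and t: "t \<noteq> 0" for p t
    proof (rule levi_form_worm_powr_pos[OF \<phi>(1) convex_on_imp_second_deriv_nonneg[OF \<phi>(3,1)] u(1) \<eta> S hd p _ _ _ _ t])
      show "(\<lambda>z. \<rho> z powr \<eta>) = (\<lambda>p. (worm_fun \<phi> p * exp (u (ln ((cmod (p $ 2))\<^sup>2)))) powr \<eta>)"
        by (simp add: \<rho>_def[abs_def] r_def ls_def)
      show "p $ 2 \<noteq> 0" using p SV by (auto simp: V_def)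
      show "0 < worm_fun \<phi> p" using rpos[OF p] by (simp add: r_def)
      have "E (ls p) > 0 \<or> \<phi> (ls p) + r p * E (ls p) > 0" using p by (auto simp: S_def U_def)
      then have "\<phi> (ls p) + r p * E (ls p) > 0"
        using rpos[OF p] \<phi>(2)[of "ls p"] by (auto intro: add_nonneg_pos)
      then show "0 < \<phi> (ln ((cmod (p $ 2))\<^sup>2)) + worm_fun \<phi> p *
          (deriv (deriv u) (ln ((cmod (p $ 2))\<^sup>2)) - \<eta> / (\<eta> - 1) * (1 + (deriv u (ln ((cmod (p $ 2))\<^sup>2)))\<^sup>2))"
        by (simp add: E_def r_def ls_def k_def)
    qed
    then show ?thesis
      using hd unfolding strictly_plurisubharmonic_on_def S_def by blast
  qed
  ultimately have "steinness_exponent (worm_domain \<phi>) V \<rho> \<le> ereal \<eta>"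
    unfolding steinness_exponent_def using \<eta> by (intro Inf_lower imageI) blast
  moreover have "steinness_index (worm_domain \<phi>) \<le> steinness_exponent (worm_domain \<phi>) V \<rho>"
    unfolding steinness_index_def using def_fun by (intro Inf_lower) blast
  ultimately show ?thesis by (rule order_trans[rotated])
qed

subsection \<open>The lower bound\<close>

lemma frechet_derivative_along_eq_0:
  fixes f :: "'a::real_normed_vector \<Rightarrow> real"
  assumes "f differentiable (at (c 0))" "(c has_vector_derivative v) (at 0)"
    and "\<forall>\<^sub>F t in nhds 0. f (c 0) \<le> f (c t)"
  shows "frechet_derivative f (at (c 0)) v = 0"
proof -
  obtain d where "d > 0" "\<And>t. dist t 0 < d \<Longrightarrow> f (c 0) \<le> f (c t)"
    using assms(3) unfolding eventually_nhds_metric by blast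
  then show ?thesis
    using DERIV_local_min[OF has_real_derivative_along_curve[OF assms(1,2)], of d] by (simp add: dist_real_def)
qed

lemma defining_function_nonneg:
  "defining_function \<Omega> V \<rho> \<Longrightarrow> p \<in> V \<Longrightarrow> p \<notin> \<Omega> \<Longrightarrow> 0 \<le> \<rho> p"
  unfolding defining_function_def by (metis (mono_tags, lifting) mem_Collect_eq not_le)

text \<open>A boundary point of an open set lies outside it, so \<open>\<rho> \<ge> 0\<close>; and
  the open set where \<open>\<rho> > 0\<close> misses the domain, hence also its closure.\<close>

lemma defining_function_eq_0:
  assumes "defining_function \<Omega> V \<rho>" "open \<Omega>" "p \<in> frontier \<Omega>"
  shows "\<rho> p = 0"
proof (rule antisym)
  have V: "open V" "closure \<Omega> \<subseteq> V" "smooth_on V \<rho>" "\<Omega> = {z \<in> V. \<rho> z < 0}"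
    using assms(1) unfolding defining_function_def by blast+
  have p: "p \<in> closure \<Omega>" "p \<notin> \<Omega>"
    using assms(2,3) by (auto simp: frontier_def interior_open)
  show "0 \<le> \<rho> p" using defining_function_nonneg[OF assms(1)] p V(2) by blast
  show "\<rho> p \<le> 0"
  proof (rule ccontr)
    assume "\<not> \<rho> p \<le> 0"
    moreover have "open (V \<inter> \<rho> -` {0<..})"
      by (rule continuous_open_preimage[OF smooth_on_imp_continuous_on[OF V(3)] V(1)]) simp
    moreover have "(V \<inter> \<rho> -` {0<..}) \<inter> \<Omega> = {}"
      using V(4) by auto
    ultimately show False
      using p V(2) open_Int_closure_eq_empty[of "V \<inter> \<rho> -` {0<..}" \<Omega>] by auto
  qed
qed

lemma pair_vec_linear_fst:
  assumes "linear (L :: complex ^ 2 \<Rightarrow> real)"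
  shows "L (pair_vec (of_real x * y) 0) = x * L (pair_vec y 0)"
    "L (pair_vec (x1 + x2) 0) = L (pair_vec x1 0) + L (pair_vec x2 0)"
proof -
  have "pair_vec (of_real x * y) 0 = x *\<^sub>R pair_vec y 0"
    unfolding scale_pair_vec(2) by (simp add: scaleR_conv_of_real)
  then show "L (pair_vec (of_real x * y) 0) = x * L (pair_vec y 0)"
    using linear_scale[OF assms] by simp
  have "pair_vec (x1 + x2) 0 = pair_vec x1 0 + pair_vec x2 0"
    by (simp add: vec_eq_iff forall_2)
  then show "L (pair_vec (x1 + x2) 0) = L (pair_vec x1 0) + L (pair_vec x2 0)"
    using linear_add[OF assms] by simp
qed

text \<open>Where the profile vanishes, the boundary contains the flat annulus \<open>z = 0\<close>.
  The parameter \<open>b\<close> may be smaller than its full half-width, which the case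
  \<open>\<beta> \<ge> pi\<close> requires.\<close>

lemma worm_annulus:
  assumes prof: "worm_profile \<beta> \<phi>" and \<rho>: "defining_function (worm_domain \<phi>) V \<rho>"
    and b: "b \<le> \<beta> - pi / 2" and w: "w \<noteq> 0" "\<bar>ln ((cmod w)\<^sup>2)\<bar> \<le> b"
  shows "pair_vec 0 w \<in> frontier (worm_domain \<phi>)" "\<rho> (pair_vec 0 w) = 0"
    "worm_fun \<phi> (pair_vec z w) = (cmod z)\<^sup>2 - 2 * (Re z * cos (ln ((cmod w)\<^sup>2)) + Im z * sin (ln ((cmod w)\<^sup>2)))"
proof -
  obtain a where \<phi>: "smooth_on UNIV \<phi>" "\<phi> -` {0} = {- (\<beta> - pi / 2)..\<beta> - pi / 2}"
      "\<forall>x. x < - a \<or> x > a \<longrightarrow> \<phi> x > 1" "\<forall>x. \<phi> x = 1 \<longrightarrow> deriv \<phi> x \<noteq> 0"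
    using prof unfolding worm_profile_def by blast
  have "ln ((cmod w)\<^sup>2) \<in> \<phi> -` {0}" unfolding \<phi>(2) using b w(2) by auto
  then have 0: "\<phi> (ln ((cmod w)\<^sup>2)) = 0" by simp
  show 1: "worm_fun \<phi> (pair_vec z w) = (cmod z)\<^sup>2 - 2 * (Re z * cos (ln ((cmod w)\<^sup>2)) + Im z * sin (ln ((cmod w)\<^sup>2)))" for z
    by (simp add: worm_fun_def 0)
  show 2: "pair_vec 0 w \<in> frontier (worm_domain \<phi>)"
    unfolding frontier_worm_domain[OF \<phi>(1,4,3)] using w(1) 1[of 0] by simp
  from defining_function_eq_0[OF \<rho> open_worm_domain[OF \<phi>(1)] 2] show "\<rho> (pair_vec 0 w) = 0" .
qed

text \<open>Along \<open>z = t * \<i> * cis s\<close> the worm function is \<open>t^2\<close>, so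
  this line avoids the domain and \<open>\<rho>\<close> has a minimum at
  \<open>t = 0\<close>.\<close>

lemma worm_annulus_tangential_derivative:
  assumes prof: "worm_profile \<beta> \<phi>" and \<rho>: "defining_function (worm_domain \<phi>) V \<rho>"
    and b: "b \<le> \<beta> - pi / 2" and w: "w \<noteq> 0" "\<bar>ln ((cmod w)\<^sup>2)\<bar> \<le> b"
  shows "frechet_derivative \<rho> (at (pair_vec 0 w)) (pair_vec (\<i> * cis (ln ((cmod w)\<^sup>2))) 0) = 0"
proof -
  define s where "s = ln ((cmod w)\<^sup>2)"
  note ann = worm_annulus[OF assms]
  have V: "open V" "closure (worm_domain \<phi>) \<subseteq> V" "smooth_on V \<rho>"
    using \<rho> unfolding defining_function_def by blast+
  have p: "pair_vec 0 w \<in> V" using ann(1) V(2) by (auto simp: frontier_def)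
  define c where "c t = pair_vec (t *\<^sub>R (\<i> * cis s)) w" for t
  have c0: "c 0 = pair_vec 0 w" by (simp add: c_def)
  have "continuous_on UNIV c"
    unfolding c_def[abs_def] by (intro continuous_on_pair_vec continuous_intros)
  then have "open (c -` V)" using open_vimage[OF V(1)] by blast
  then have "\<forall>\<^sub>F t in nhds 0. t \<in> c -` V"
    by (rule eventually_nhds_in_open) (simp add: c0 p)
  then have ge: "\<forall>\<^sub>F t in nhds 0. \<rho> (c 0) \<le> \<rho> (c t)"
  proof eventually_elim
    fix t assume "t \<in> c -` V"
    moreover have "c t \<notin> worm_domain \<phi>"
      unfolding worm_domain_eq c_def mem_Collect_eq ann(3) s_def[symmetric] by (simp add: algebra_simps not_less)
    ultimately show "\<rho> (c 0) \<le> \<rho> (c t)"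
      using defining_function_nonneg[OF \<rho>] ann(2) by (simp add: c0)
  qed
  have "(c has_vector_derivative pair_vec (\<i> * cis s) 0) (at 0)"
    unfolding c_def[abs_def]
    by (intro pair_vec_has_vector_derivative) (auto intro!: derivative_eq_intros)
  from frechet_derivative_along_eq_0[of \<rho> c, OF _ this ge] show ?thesis
    using smooth_on_differentiable[OF V(3) p] by (simp add: c0 s_def)
qed

text \<open>Split \<open>- cis (\<mu> * s)\<close> into its components along \<open>- cis s\<close>
  and \<open>\<i> * cis s\<close>; the tangential one contributes nothing, and the other has the
  cosine as coefficient.\<close>

lemma worm_annulus_derivative_cos:
  assumes prof: "worm_profile \<beta> \<phi>" and \<rho>: "defining_function (worm_domain \<phi>) V \<rho>"
    and b: "b \<le> \<beta> - pi / 2" and w: "w \<noteq> 0" "\<bar>ln ((cmod w)\<^sup>2)\<bar> \<le> b"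
  defines "s \<equiv> ln ((cmod w)\<^sup>2)"
  shows "frechet_derivative \<rho> (at (pair_vec 0 w)) (pair_vec (- cis (\<mu> * s)) 0)
    = cos ((1 - \<mu>) * s) * frechet_derivative \<rho> (at (pair_vec 0 w)) (pair_vec (- cis s) 0)"
proof -
  have V: "open V" "closure (worm_domain \<phi>) \<subseteq> V" "smooth_on V \<rho>"
    using \<rho> unfolding defining_function_def by blast+
  have "pair_vec 0 w \<in> V" using worm_annulus(1)[OF assms(1-5)] V(2) by (auto simp: frontier_def)
  then have lin: "linear (frechet_derivative \<rho> (at (pair_vec 0 w)))"
    using smooth_on_differentiable[OF V(3)] linear_frechet_derivative by blast
  have rot: "cis s * cis (- y) = of_real (cos y) * cis s - of_real (sin y) * (\<i> * cis s)" for y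
    by (simp add: complex_eq_iff algebra_simps)
  have "cis (\<mu> * s) = cis s * cis (- ((1 - \<mu>) * s))"
    unfolding cis_mult by (simp add: algebra_simps)
  also have "\<dots> = of_real (cos ((1 - \<mu>) * s)) * cis s - of_real (sin ((1 - \<mu>) * s)) * (\<i> * cis s)"
    by (rule rot)
  finally have "- cis (\<mu> * s) = of_real (cos ((1 - \<mu>) * s)) * (- cis s) + of_real (sin ((1 - \<mu>) * s)) * (\<i> * cis s)"
    by simp
  then show ?thesis
    using worm_annulus_tangential_derivative[OF assms(1-5)]
    by (simp only: pair_vec_linear_fst[OF lin] s_def)
qed

text \<open>Otherwise the derivative would vanish in every direction: \<open>\<i>\<close> is
  tangential, and \<open>\<rho>\<close> is zero along the annulus in the \<open>w\<close>
  directions.\<close>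

lemma worm_annulus_normal_derivative:
  assumes prof: "worm_profile \<beta> \<phi>" and \<rho>: "defining_function (worm_domain \<phi>) V \<rho>"
    and b: "0 < b" "b \<le> \<beta> - pi / 2"
  shows "frechet_derivative \<rho> (at (pair_vec 0 1)) (pair_vec (- 1) 0) \<noteq> 0"
proof
  let ?D = "frechet_derivative \<rho> (at (pair_vec 0 1))"
  assume 0: "?D (pair_vec (- 1) 0) = 0"
  have V: "open V" "closure (worm_domain \<phi>) \<subseteq> V" "smooth_on V \<rho>"
    "\<forall>z\<in>frontier (worm_domain \<phi>). frechet_derivative \<rho> (at z) \<noteq> (\<lambda>v. 0)"
    using \<rho> unfolding defining_function_def by blast+
  have one: "(1::complex) \<noteq> 0" "\<bar>ln ((cmod 1)\<^sup>2)\<bar> \<le> b" using b by auto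
  note ann = worm_annulus[OF prof \<rho> b(2) one]
  have "pair_vec 0 1 \<in> V" using ann(1) V(2) by (auto simp: frontier_def)
  then have diff: "\<rho> differentiable (at (pair_vec 0 1))"
    by (rule smooth_on_differentiable[OF V(3)])
  then have lin: "linear ?D" by (rule linear_frechet_derivative)
  have i: "?D (pair_vec \<i> 0) = 0"
    using worm_annulus_tangential_derivative[OF prof \<rho> b(2) one] by simp
  have "?D v = 0" for v
  proof -
    \<comment> \<open>For small \<open>t\<close> this curve stays in the annulus, because
      \<open>b > 0\<close> and \<open>w = 1\<close> has \<open>s = 0\<close>.\<close>
    define c where "c t = pair_vec 0 (exp (of_real t * v $ 2))" for t
    have c0: "c 0 = pair_vec 0 1" by (simp add: c_def)
    have "((\<lambda>t. 2 * t * Re (v $ 2)) \<longlongrightarrow> 2 * 0 * Re (v $ 2)) (nhds 0)"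
      by (intro tendsto_intros filterlim_ident)
    then have "\<forall>\<^sub>F t in nhds 0. dist (2 * t * Re (v $ 2)) (2 * 0 * Re (v $ 2)) < b"
      using b(1) by (rule tendstoD)
    then have "\<forall>\<^sub>F t in nhds 0. \<rho> (c 0) \<le> \<rho> (c t)"
    proof eventually_elim
      fix t assume t: "dist (2 * t * Re (v $ 2)) (2 * 0 * Re (v $ 2)) < b"
      have "\<bar>ln ((cmod (exp (of_real t * v $ 2)))\<^sup>2)\<bar> \<le> b"
        using t ln_cmod_exp[of 1 "of_real t * v $ 2"] by (simp add: dist_real_def)
      from worm_annulus(2)[OF prof \<rho> b(2) _ this] show "\<rho> (c 0) \<le> \<rho> (c t)"
        using ann(2) by (simp add: c_def)
    qed
    moreover have "(c has_vector_derivative pair_vec 0 (v $ 2)) (at 0)"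
    proof -
      have "((\<lambda>x. exp x) has_field_derivative 1) (at (of_real 0 * v $ 2))"
        by (auto intro!: derivative_eq_intros)
      from has_vector_derivative_complex_line[OF this] show ?thesis
        unfolding c_def[abs_def] by (intro pair_vec_has_vector_derivative) auto
    qed
    ultimately have "?D (pair_vec 0 (v $ 2)) = 0"
      using frechet_derivative_along_eq_0[of \<rho> c "pair_vec 0 (v $ 2)"] diff by (simp add: c0)
    moreover have "?D (pair_vec (v $ 1) 0) = 0"
    proof -
      have "v $ 1 = of_real (- Re (v $ 1)) * (- 1) + of_real (Im (v $ 1)) * \<i>"
        by (simp add: complex_eq_iff)
      then have "?D (pair_vec (v $ 1) 0) = ?D (pair_vec (of_real (- Re (v $ 1)) * (- 1) + of_real (Im (v $ 1)) * \<i>) 0)"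
        by (rule arg_cong)
      then show ?thesis by (simp only: pair_vec_linear_fst[OF lin] 0 i)
    qed
    moreover have "v = pair_vec (v $ 1) 0 + pair_vec 0 (v $ 2)"
      by (simp add: vec_eq_iff forall_2)
    ultimately show ?thesis using linear_add[OF lin] by (metis add_0)
  qed
  then show False using V(4) ann(1) by blast
qed

section \<open>The maximum principle on a small holomorphic disc\<close>

text \<open>The last bound on \<open>b\<close> is the inequality
  \<open>\<eta> * \<bar>\<mu>\<bar> < pi / (2 * b)\<close>. A rescaled strictly subharmonic function
  is compared with a strictly superharmonic one that touches its limit from above at an interior
  point of the strip.\<close>

lemma worm_no_exponent:
  assumes prof: "worm_profile \<beta> \<phi>" and \<rho>: "defining_function (worm_domain \<phi>) V \<rho>"
    and U: "open U" "frontier (worm_domain \<phi>) \<subseteq> U" "U \<subseteq> V"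
    and psh: "strictly_plurisubharmonic_on (- closure (worm_domain \<phi>) \<inter> U) (\<lambda>z. \<rho> z powr \<eta>)"
    and \<eta>: "\<eta> > 1" and b: "0 < b" "b \<le> \<beta> - pi / 2" "b \<le> pi / 2" "\<eta> * (pi / 2 - b) < pi / 2"
  shows False
proof -
  obtain a0 where \<phi>: "smooth_on UNIV \<phi>"
      "\<forall>x. x < - a0 \<or> x > a0 \<longrightarrow> \<phi> x > 1" "\<forall>x. \<phi> x = 1 \<longrightarrow> deriv \<phi> x \<noteq> 0"
    using prof unfolding worm_profile_def by blast
  note clos = closure_worm_domain[OF \<phi>(1,3,2)]
  have V: "open V" "smooth_on V \<rho>"
    using \<rho> unfolding defining_function_def by blast+
  define f where "f p = \<rho> p powr \<eta>" for p
  define S where "S = - closure (worm_domain \<phi>) \<inter> U"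
  have S: "open S" "S \<subseteq> U" using U(1) by (auto simp: S_def)
  have f: "higher_differentiable_on S f 2" "\<And>p t. p \<in> S \<Longrightarrow> t \<noteq> 0 \<Longrightarrow> 0 < Re (levi_form f p t)"
    using psh unfolding strictly_plurisubharmonic_on_def S_def f_def[abs_def] by blast+
  \<comment> \<open>With this slope the curves \<open>\<Gamma>\<close> below become tangent to the boundary exactly over \<open>\<bar>s\<bar> = b\<close>,
    so the rescaled limit of the plurisubharmonic function vanishes at both ends of the strip.\<close>
  define \<mu> where "\<mu> = 1 - pi / (2 * b)"
  have \<mu>: "\<mu> \<le> 0" "(1 - \<mu>) * b = pi / 2" using b by (auto simp: \<mu>_def field_simps)
  have "\<eta> * - \<mu> = \<eta> * (pi / 2 - b) / b" using b(1) by (simp add: \<mu>_def field_simps)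
  also have "\<dots> < pi / 2 / b" using b(1,4) by (rule divide_strict_right_mono[rotated])
  finally have "\<eta> * - \<mu> < pi / (2 * b)" by simp
  \<comment> \<open>The upper bound keeps \<open>cos (k * s)\<close> positive on the closed strip;
    the lower one makes the comparison function strictly superharmonic.\<close>
  then obtain k where k: "\<eta> * - \<mu> < k" "k < pi / (2 * b)" using dense by blast
  have k0: "0 < k" "k * b < pi / 2"
    using k \<mu>(1) \<eta> b(1) mult_nonneg_nonpos[of \<eta> \<mu>] by (auto simp: field_simps)
  have cosk: "0 < cos (k * x)" if "\<bar>x\<bar> \<le> b" for x
  proof -
    have "\<bar>k * x\<bar> \<le> k * b" using that k0 by (simp add: abs_mult)
    then show ?thesis using k0(2) by (intro cos_gt_zero_pi) auto
  qed
  have kdiff: "k\<^sup>2 - (\<eta> * \<mu>)\<^sup>2 > 0"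
  proof -
    have "\<bar>\<eta> * \<mu>\<bar> < \<bar>k\<bar>" using k(1) k0(1) \<mu>(1) \<eta> mult_nonneg_nonpos[of \<eta> \<mu>] by auto
    then have "(\<eta> * \<mu>)\<^sup>2 < k\<^sup>2" using abs_le_square_iff[of k "\<eta> * \<mu>"] by linarith
    then show ?thesis by simp
  qed

  define ls where "ls w = ln ((cmod w)\<^sup>2)" for w :: complex
  define D1 where "D1 p = frechet_derivative \<rho> (at p) (pair_vec 1 0)" for p
  define D2 where "D2 p = frechet_derivative \<rho> (at p) (pair_vec \<i> 0)" for p
  have contD: "continuous_on V D1" "continuous_on V D2"
    unfolding D1_def[abs_def] D2_def[abs_def]
    using smooth_on_imp_continuous_on[OF smooth_on_frechet_derivative[OF V(2)]] by blast+
  have D: "frechet_derivative \<rho> (at p) (pair_vec a 0) = Re a * D1 p + Im a * D2 p" if "p \<in> V" for p a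
  proof -
    have "linear (frechet_derivative \<rho> (at p))"
      using smooth_on_differentiable[OF V(2) that] linear_frechet_derivative by blast
    note lin = pair_vec_linear_fst[OF this]
    have "a = of_real (Re a) * 1 + of_real (Im a) * \<i>" by (simp add: complex_eq_iff)
    then have "frechet_derivative \<rho> (at p) (pair_vec a 0)
      = frechet_derivative \<rho> (at p) (pair_vec (of_real (Re a) * 1 + of_real (Im a) * \<i>) 0)" by (rule arg_cong)
    then show ?thesis by (simp only: lin D1_def D2_def)
  qed
  have ann_U: "pair_vec 0 w \<in> U" if "w \<noteq> 0" "\<bar>ls w\<bar> \<le> b" for w
    using worm_annulus(1)[OF prof \<rho> b(2)] that U(2) unfolding ls_def by blast
  have ann_0: "\<rho> (pair_vec 0 w) = 0" if "w \<noteq> 0" "\<bar>ls w\<bar> \<le> b" for w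
    using worm_annulus(2)[OF prof \<rho> b(2)] that unfolding ls_def by blast

  \<comment> \<open>The derivative of \<open>\<rho>\<close> at \<open>(0, w)\<close> in the
    direction of the curves, without its exponential factor. By \<open>d\<close> below it carries
    the factor \<open>cos ((1 - \<mu>) * s)\<close>, zero at
    \<open>\<bar>s\<bar> = b\<close>.\<close>
  define d where "d w = - cos (\<mu> * ls w) * D1 (pair_vec 0 w) - sin (\<mu> * ls w) * D2 (pair_vec 0 w)" for w
  have d: "d w = cos ((1 - \<mu>) * ls w) * frechet_derivative \<rho> (at (pair_vec 0 w)) (pair_vec (- cis (ls w)) 0)"
    if "w \<noteq> 0" "\<bar>ls w\<bar> \<le> b" for w
    using worm_annulus_derivative_cos[OF prof \<rho> b(2), of w \<mu>] that D[of "pair_vec 0 w" "- cis (\<mu> * ls w)"]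
      ann_U[OF that] U(3) unfolding ls_def d_def by auto
  define K where "K = {w :: complex. w \<noteq> 0 \<and> \<bar>ls w\<bar> \<le> b}"
  \<comment> \<open>Closedness of \<open>K\<close> is not visible through a logarithm at
    \<open>w = 0\<close>; inequalities for \<open>|w|^2\<close> are closed conditions.\<close>
  have K_eq: "K = {w. exp (- b) \<le> (cmod w)\<^sup>2 \<and> (cmod w)\<^sup>2 \<le> exp b}"
  proof -
    have "w \<noteq> 0 \<and> \<bar>ls w\<bar> \<le> b \<longleftrightarrow> exp (- b) \<le> (cmod w)\<^sup>2 \<and> (cmod w)\<^sup>2 \<le> exp b" for w
    proof (cases "w = 0")
      case False
      then have "(cmod w)\<^sup>2 = exp (ls w)" by (simp add: ls_def)
      then show ?thesis using False by (simp add: abs_le_iff) linarith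
    qed (simp add: not_le)
    then show ?thesis by (simp add: K_def)
  qed
  have "compact K"
  proof (rule compact_eq_bounded_closed[THEN iffD2, OF conjI])
    have "cmod w \<le> sqrt (exp b)" if "w \<in> K" for w
      using that by (auto simp: K_eq intro: real_le_rsqrt)
    then show "bounded K" unfolding bounded_iff by blast
    show "closed K" unfolding K_eq Collect_conj_eq
      by (intro closed_Int closed_Collect_le continuous_intros)
  qed
  have contls: "continuous_on K ls"
    unfolding ls_def[abs_def] by (intro continuous_intros) (auto simp: K_def)
  have contd: "continuous_on K d"
  proof -
    have "continuous_on K (\<lambda>w. pair_vec 0 w)" by (intro continuous_on_pair_vec continuous_intros)
    moreover have "(\<lambda>w. pair_vec 0 w) ` K \<subseteq> V" using ann_U U(3) by (auto simp: K_def)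
    ultimately have "continuous_on K (\<lambda>w. D1 (pair_vec 0 w))" "continuous_on K (\<lambda>w. D2 (pair_vec 0 w))"
      using continuous_on_compose2 contD by blast+
    then show ?thesis unfolding d_def[abs_def] by (intro continuous_intros contls)
  qed
  \<comment> \<open>The exponential factors of limit and comparison function cancel, so their
    quotient lives on the compact annulus \<open>K\<close> and attains its maximum, although the
    strip of the variable \<open>\<zeta>\<close> is unbounded.\<close>
  define q where "q w = \<bar>d w\<bar> powr \<eta> / cos (k * ls w)" for w
  have contq: "continuous_on K q"
    unfolding q_def[abs_def] using \<eta> cosk
    by (intro continuous_on_divide continuous_on_powr' continuous_intros contls contd) (auto simp: K_def less_imp_neq[symmetric])
  have K1: "1 \<in> K" using b(1) by (simp add: K_def ls_def)
  obtain w0 where w0: "w0 \<in> K" "\<And>w. w \<in> K \<Longrightarrow> q w \<le> q w0"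
    using continuous_attains_sup[OF \<open>compact K\<close> _ contq] K1 by blast
  define m where "m = q w0"
  have "q 1 > 0"
  proof -
    have "d 1 \<noteq> 0"
      using d[of 1] b(1) worm_annulus_normal_derivative[OF prof \<rho> b(1,2)] by (simp add: ls_def)
    then show ?thesis by (simp add: q_def ls_def)
  qed
  then have m: "m > 0" using w0(2)[OF K1] by (simp add: m_def)
  have dle: "\<bar>d w\<bar> powr \<eta> \<le> m * cos (k * ls w)" if "w \<in> K" for w
    using w0(2)[OF that] cosk[of "ls w"] that by (simp add: q_def m_def K_def pos_divide_le_eq)
  have deq: "\<bar>d w0\<bar> powr \<eta> = m * cos (k * ls w0)"
    using cosk[of "ls w0"] w0(1) by (simp add: q_def m_def K_def)
  define s0 where "s0 = ls w0"
  have w00: "w0 \<noteq> 0" "\<bar>s0\<bar> \<le> b" using w0(1) by (auto simp: K_def s0_def)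
  \<comment> \<open>At the ends of the strip the limit vanishes, whereas the maximum is positive
    because \<open>q 1 > 0\<close>.\<close>
  have "\<bar>s0\<bar> \<noteq> b"
  proof
    assume "\<bar>s0\<bar> = b"
    then have "cos ((1 - \<mu>) * s0) = 0"
      using \<mu>(2) by (metis abs_if cos_minus cos_pi_half mult_minus_right)
    then have "d w0 = 0" using d[of w0] w00 by (simp add: s0_def)
    then have "m = 0" by (simp add: m_def q_def)
    with m show False by simp
  qed
  with w00 have s0: "\<bar>s0\<bar> < b" by simp

  define r where "r = (b - \<bar>s0\<bar>) / 2"
  have r: "r > 0" "\<bar>s0\<bar> + r < b" using s0 by (auto simp: r_def field_simps)
  define B where "B = cball (0::complex) r"
  \<comment> \<open>The curves recentred at the maximum point: \<open>x = 0\<close> corresponds to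
    \<open>w0\<close>. Below, \<open>\<Gamma>\<close> takes \<open>\<delta>\<close> and
    \<open>x\<close> jointly so that compactness gives uniform estimates as \<open>\<delta>\<close>
    tends to 0.\<close>
  define a where "a x = - exp (\<i> * of_real \<mu> * (of_real s0 + x))" for x :: complex
  define h where "h x = w0 * exp (x / 2)" for x :: complex
  define \<Gamma> where "\<Gamma> y = pair_vec (of_real (fst y) * a (snd y)) (h (snd y))" for y :: "real \<times> complex"
  have h0: "h x \<noteq> 0" for x using w00 by (simp add: h_def)
  have lsh: "ls (h x) = s0 + Re x" for x
    using ln_cmod_exp[OF w00(1), of "x / 2"] by (simp add: ls_def h_def s0_def)
  have Bs: "\<bar>s0 + Re x\<bar> < b" if "x \<in> B" for x
    using that r abs_Re_le_cmod[of x] unfolding B_def by simp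
  have a_eq: "a x = of_real (exp (- \<mu> * Im x)) * - cis (\<mu> * (s0 + Re x))" for x
  proof -
    have "\<i> * of_real \<mu> * (of_real s0 + x) = of_real (- \<mu> * Im x) + \<i> * of_real (\<mu> * (s0 + Re x))"
      by (simp add: complex_eq_iff algebra_simps)
    then show ?thesis
      unfolding a_def by (simp only: exp_add exp_of_real cis_conv_exp mult_minus_right)
  qed
  have hK: "h x \<in> K" if "x \<in> B" for x using Bs[OF that] h0[of x] by (simp add: K_def lsh)
  \<comment> \<open>The product of \<open>z\<close> with the conjugate of \<open>cis s\<close> has
    real part \<open>- \<delta> * exp (- \<mu> * Im x) * C\<close> with \<open>C \<ge> 0\<close> on
    the strip, so \<open>worm_fun\<close> is at least \<open>|z|^2 > 0\<close>.\<close>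
  have outside: "\<Gamma> (\<delta>, x) \<notin> closure (worm_domain \<phi>)" if "\<delta> > 0" "x \<in> B" for \<delta> x
  proof -
    define z where "z = of_real \<delta> * a x"
    define C where "C = cos ((1 - \<mu>) * (s0 + Re x))"
    have "\<bar>(1 - \<mu>) * (s0 + Re x)\<bar> \<le> (1 - \<mu>) * b"
      using Bs[OF that(2)] \<mu>(1) by (simp add: abs_mult mult_left_mono)
    then have C: "C \<ge> 0" unfolding \<mu>(2) C_def by (intro cos_ge_zero) auto
    have "Re z * cos (s0 + Re x) + Im z * sin (s0 + Re x)
      = - (\<delta> * exp (- \<mu> * Im x) * (cos (s0 + Re x) * cos (\<mu> * (s0 + Re x)) + sin (s0 + Re x) * sin (\<mu> * (s0 + Re x))))"
      unfolding z_def a_eq by (simp add: algebra_simps)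
    also have "\<dots> = - (\<delta> * exp (- \<mu> * Im x) * C)"
      unfolding C_def cos_diff[symmetric] by (simp add: algebra_simps)
    also have "\<dots> \<le> 0" using C that(1) by simp
    finally have le: "Re z * cos (s0 + Re x) + Im z * sin (s0 + Re x) \<le> 0" .
    have pos: "(cmod z)\<^sup>2 > 0" using that(1) by (simp add: z_def a_def)
    have eq: "worm_fun \<phi> (pair_vec z (h x))
        = (cmod z)\<^sup>2 - 2 * (Re z * cos (s0 + Re x) + Im z * sin (s0 + Re x))"
      using worm_annulus(3)[OF prof \<rho> b(2) h0[of x], of z] lsh[of x] Bs[OF that(2)] by (simp add: ls_def)
    have "0 < y - 2 * v" if "0 < y" "v \<le> 0" for y v :: real using that by simp
    from this[OF pos le] have "worm_fun \<phi> (pair_vec z (h x)) > 0" unfolding eq .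
    then show ?thesis unfolding clos by (simp add: \<Gamma>_def z_def)
  qed
  have cont\<Gamma>: "continuous_on UNIV \<Gamma>"
    unfolding \<Gamma>_def[abs_def] a_def h_def by (intro continuous_on_pair_vec continuous_intros) auto
  have cB: "compact B" by (simp add: B_def)
  \<comment> \<open>At \<open>\<delta> = 0\<close> the compact disc lands in the boundary, hence in
    the open set \<open>U\<close>; a tube around it does too.\<close>
  obtain \<delta>1 where \<delta>1: "\<delta>1 > 0" "\<And>\<delta> x. 0 \<le> \<delta> \<Longrightarrow> \<delta> \<le> \<delta>1 \<Longrightarrow> x \<in> B \<Longrightarrow> \<Gamma> (\<delta>, x) \<in> U"
  proof -
    have "compact ({0::real} \<times> B)" using cB by (intro compact_Times) auto
    moreover have "open (\<Gamma> -` U)" using open_vimage[OF U(1) cont\<Gamma>] .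
    moreover have "{0::real} \<times> B \<subseteq> \<Gamma> -` U"
      using ann_U hK by (auto simp: \<Gamma>_def K_def)
    ultimately obtain e where e: "e > 0" "(\<Union>y\<in>{0::real} \<times> B. ball y e) \<subseteq> \<Gamma> -` U"
      using compact_subset_open_imp_ball_epsilon_subset by blast
    show ?thesis
    proof (rule that[of "e / 2"])
      fix \<delta> x assume y: "0 \<le> \<delta>" "\<delta> \<le> e / 2" "x \<in> B"
      then have "(\<delta>, x) \<in> ball (0, x) e" using e(1) by (simp add: dist_Pair_Pair)
      then show "\<Gamma> (\<delta>, x) \<in> U" using y(3) e(2) by blast
    qed (use e in simp)
  qed
  \<comment> \<open>\<open>H\<close> is the derivative of \<open>\<rho>\<close> along
    \<open>\<Gamma>\<close> with respect to \<open>\<delta>\<close>.\<close>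
  define H where "H y = Re (a (snd y)) * D1 (\<Gamma> y) + Im (a (snd y)) * D2 (\<Gamma> y)" for y
  have contH: "continuous_on ({0..\<delta>1} \<times> B) H"
  proof -
    have "continuous_on ({0..\<delta>1} \<times> B) \<Gamma>" by (rule continuous_on_subset[OF cont\<Gamma>]) simp
    moreover have "\<Gamma> ` ({0..\<delta>1} \<times> B) \<subseteq> V" using \<delta>1(2) U(3) by auto
    ultimately have "continuous_on ({0..\<delta>1} \<times> B) (\<lambda>y. D1 (\<Gamma> y))" "continuous_on ({0..\<delta>1} \<times> B) (\<lambda>y. D2 (\<Gamma> y))"
      using continuous_on_compose2 contD by blast+
    then show ?thesis unfolding H_def[abs_def] a_def by (intro continuous_intros)
  qed
  have contHH: "continuous_on ({0..\<delta>1} \<times> B) (\<lambda>y. \<bar>H y\<bar> powr \<eta>)"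
    using \<eta> by (intro continuous_on_powr' continuous_intros contH) auto
  have H0: "\<bar>H (0, x)\<bar> powr \<eta> = exp (- (\<eta> * \<mu>) * Im x) * \<bar>d (h x)\<bar> powr \<eta>" if "x \<in> B" for x
  proof -
    have "H (0, x) = exp (- \<mu> * Im x) * d (h x)"
      unfolding H_def d_def \<Gamma>_def lsh by (simp add: a_eq algebra_simps)
    then show ?thesis by (simp add: abs_mult powr_mult powr_def[of "exp _"] algebra_simps)
  qed
  define h1 where "h1 x = exp (- (\<eta> * \<mu>) * Im x) * cos (k * (s0 + Re x))" for x
  have conth1: "continuous_on B h1" unfolding h1_def[abs_def] by (intro continuous_intros)
  have h1pos: "h1 x > 0" if "x \<in> B" for x
    using cosk[of "s0 + Re x"] Bs[OF that] by (simp add: h1_def)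
  have H0le: "\<bar>H (0, x)\<bar> powr \<eta> \<le> m * h1 x" if "x \<in> B" for x
    using mult_left_mono[OF dle[OF hK[OF that]], of "exp (- (\<eta> * \<mu>) * Im x)"]
    unfolding H0[OF that] lsh h1_def by (simp add: mult.left_commute)
  have B0: "0 \<in> B" using r by (simp add: B_def)
  have H0eq: "\<bar>H (0, 0)\<bar> powr \<eta> = m * h1 0"
    using deq unfolding H0[OF B0] by (simp add: h1_def h_def s0_def)
  obtain x1 where "x1 \<in> B" "\<And>x. x \<in> B \<Longrightarrow> h1 x1 \<le> h1 x"
    using continuous_attains_inf[OF cB _ conth1] B0 by blast
  define c where "c = h1 x1"
  have c: "c > 0" "\<And>x. x \<in> B \<Longrightarrow> c \<le> h1 x"
    using h1pos \<open>x1 \<in> B\<close> \<open>\<And>x. x \<in> B \<Longrightarrow> h1 x1 \<le> h1 x\<close> by (auto simp: c_def)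
  \<comment> \<open>The quadratic term adds \<open>4 * e\<close> to the Laplacian; the denominator 8
    keeps that to half of the available negativity.\<close>
  define e where "e = (k\<^sup>2 - (\<eta> * \<mu>)\<^sup>2) * c / 8"
  have e: "e > 0" using kdiff c by (simp add: e_def)
  \<comment> \<open>A strictly superharmonic comparison function on \<open>B\<close>; the quadratic term makes the maximum of the
    rescaled limit minus \<open>N\<close> strict.\<close>
  define N where "N x = m * (h1 x + e * (cmod x)\<^sup>2)" for x

  \<comment> \<open>The tolerance is half of \<open>m * e * r^2\<close>, the margin that the
    quadratic term provides on the circle of radius \<open>r\<close>.\<close>
  obtain \<delta>2 where \<delta>2: "\<delta>2 > 0" "\<And>\<delta> x. 0 \<le> \<delta> \<Longrightarrow> \<delta> \<le> \<delta>1 \<Longrightarrow> \<delta> < \<delta>2 \<Longrightarrow> x \<in> B \<Longrightarrow>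
      dist (\<bar>H (\<delta>, x)\<bar> powr \<eta>) (\<bar>H (0, x)\<bar> powr \<eta>) < m * e * r\<^sup>2 / 2"
  proof -
    have "compact ({0..\<delta>1} \<times> B)" using cB by (intro compact_Times) auto
    then have "uniformly_continuous_on ({0..\<delta>1} \<times> B) (\<lambda>y. \<bar>H y\<bar> powr \<eta>)"
      using compact_uniformly_continuous contHH by blast
    moreover have "m * e * r\<^sup>2 / 2 > 0" using m e r by simp
    ultimately obtain d2 where "d2 > 0" and d2: "\<And>y y'. y \<in> {0..\<delta>1} \<times> B \<Longrightarrow> y' \<in> {0..\<delta>1} \<times> B \<Longrightarrow>
        dist y' y < d2 \<Longrightarrow> dist (\<bar>H y'\<bar> powr \<eta>) (\<bar>H y\<bar> powr \<eta>) < m * e * r\<^sup>2 / 2"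
      unfolding uniformly_continuous_on_def by metis
    show ?thesis
    proof (rule that[OF \<open>d2 > 0\<close>])
      fix \<delta> x assume "0 \<le> \<delta>" "\<delta> \<le> \<delta>1" "\<delta> < d2" "x \<in> B"
      then show "dist (\<bar>H (\<delta>, x)\<bar> powr \<eta>) (\<bar>H (0, x)\<bar> powr \<eta>) < m * e * r\<^sup>2 / 2"
        using \<delta>1(1) by (intro d2) (auto simp: dist_Pair_Pair)
    qed
  qed
  define \<delta> where "\<delta> = min \<delta>1 \<delta>2 / 2"
  have \<delta>: "0 < \<delta>" "\<delta> \<le> \<delta>1" "\<delta> < \<delta>2" using \<delta>1(1) \<delta>2(1) by (auto simp: \<delta>_def)
  have inS: "\<Gamma> (\<delta>, x) \<in> S" if "x \<in> B" for x
    using outside[OF \<delta>(1) that] \<delta>1(2)[of \<delta> x] \<delta> that by (simp add: S_def)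
  \<comment> \<open>The mean value theorem in \<open>\<delta>\<close>, starting from
    \<open>\<rho> = 0\<close>, writes the rescaled power as
    \<open>\<bar>H (t, x)\<bar> powr \<eta>\<close> for some \<open>t\<close> between 0 and
    \<open>\<delta>\<close>.\<close>
  have approx: "\<bar>f (\<Gamma> (\<delta>, x)) / \<delta> powr \<eta> - \<bar>H (0, x)\<bar> powr \<eta>\<bar> < m * e * r\<^sup>2 / 2" if x: "x \<in> B" for x
  proof -
    have "((\<lambda>t. \<rho> (\<Gamma> (t, x))) has_real_derivative H (t, x)) (at t)" if "0 \<le> t" "t \<le> \<delta>" for t
    proof -
      have \<Gamma>V: "\<Gamma> (t, x) \<in> V" using \<delta>1(2)[of t x] that \<delta> x U(3) by auto
      have "((\<lambda>t. \<Gamma> (t, x)) has_vector_derivative pair_vec (a x) 0) (at t)"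
        unfolding \<Gamma>_def fst_conv snd_conv
        by (intro pair_vec_has_vector_derivative) (auto intro!: derivative_eq_intros)
      from has_real_derivative_along_curve[OF _ this, of \<rho>] show ?thesis
        using smooth_on_differentiable[OF V(2) \<Gamma>V] D[OF \<Gamma>V] by (simp add: H_def)
    qed
    from MVT2[OF \<delta>(1) this]
    obtain t where t: "0 < t" "t < \<delta>" "\<rho> (\<Gamma> (\<delta>, x)) - \<rho> (\<Gamma> (0, x)) = (\<delta> - 0) * H (t, x)"
      by auto
    have "\<rho> (\<Gamma> (0, x)) = 0"
      using ann_0[of "h x"] hK[OF x] by (simp add: \<Gamma>_def K_def)
    then have 1: "\<rho> (\<Gamma> (\<delta>, x)) = \<delta> * H (t, x)" using t by simp
    moreover have "0 \<le> \<rho> (\<Gamma> (\<delta>, x))"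
      using defining_function_nonneg[OF \<rho>, of "\<Gamma> (\<delta>, x)"] inS[OF x] U(3) closure_subset[of "worm_domain \<phi>"]
      by (auto simp: S_def)
    ultimately have "\<rho> (\<Gamma> (\<delta>, x)) = \<delta> * \<bar>H (t, x)\<bar>"
      using \<delta>(1) by (simp add: zero_le_mult_iff)
    then have "f (\<Gamma> (\<delta>, x)) / \<delta> powr \<eta> = \<bar>H (t, x)\<bar> powr \<eta>"
      using \<delta>(1) by (simp add: f_def powr_mult)
    then show ?thesis using \<delta>2(2)[of t x] t \<delta> x by (simp add: dist_real_def)
  qed

  define J where "J x = f (\<Gamma> (\<delta>, x)) / \<delta> powr \<eta> - N x" for x
  have contJ: "continuous_on B J"
  proof -
    have "continuous_on S f"
      using higher_differentiable_on_SucD[OF higher_differentiable_on_SucD[OF f(1)[unfolded numeral_2_eq_2]]] by simp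
    moreover have "continuous_on B (\<lambda>x. \<Gamma> (\<delta>, x))"
      by (rule continuous_on_compose2[OF cont\<Gamma>]) (auto intro!: continuous_intros)
    ultimately have "continuous_on B (\<lambda>x. f (\<Gamma> (\<delta>, x)))"
      by (rule continuous_on_compose2) (use inS in auto)
    then show ?thesis unfolding J_def[abs_def] N_def[abs_def]
      using \<delta>(1) by (intro continuous_intros conth1) auto
  qed
  obtain x0 where x0: "x0 \<in> B" "\<And>x. x \<in> B \<Longrightarrow> J x \<le> J x0"
    using continuous_attains_sup[OF cB _ contJ] B0 by blast
  have "- (m * e * r\<^sup>2 / 2) < J 0"
  proof -
    have "N 0 = m * h1 0" by (simp add: N_def)
    then show ?thesis using approx[OF B0] unfolding H0eq J_def abs_less_iff by linarith
  qed
  then have J0: "- (m * e * r\<^sup>2 / 2) < J x0" using x0(2)[OF B0] by simp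
  \<comment> \<open>On the circle \<open>J\<close> lies below \<open>- (m * e * r^2 / 2)\<close>,
    while its value at the centre lies above; the maximum is therefore interior.\<close>
  have "cmod x0 \<noteq> r"
  proof
    assume "cmod x0 = r"
    then have "N x0 = m * h1 x0 + m * e * r\<^sup>2" by (simp add: N_def algebra_simps)
    then have "J x0 < - (m * e * r\<^sup>2 / 2)"
      using approx[OF x0(1)] H0le[OF x0(1)] unfolding J_def abs_less_iff by linarith
    then show False using J0 by simp
  qed
  then have x0r: "x0 \<in> ball 0 r" using x0(1) by (simp add: B_def)

  define g1 where "g1 x = of_real \<delta> * a (x0 + x)" for x
  define g1' where "g1' x = of_real \<delta> * (- (exp (\<i> * of_real \<mu> * (of_real s0 + (x0 + x))) * (\<i> * of_real \<mu>)))" for x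
  have g1: "(g1 has_field_derivative g1' x) (at x)" for x
    unfolding g1_def[abs_def] a_def g1'_def by (auto intro!: derivative_eq_intros)
  obtain g2 where g2: "(g1' has_field_derivative g2) (at 0)"
  proof
    show "(g1' has_field_derivative (of_real \<delta> * (- (exp (\<i> * of_real \<mu> * (of_real s0 + x0)) * (\<i> * of_real \<mu>) * (\<i> * of_real \<mu>))))) (at 0)"
      unfolding g1'_def[abs_def] by (auto intro!: derivative_eq_intros)
  qed
  have k1: "((\<lambda>x. h (x0 + x)) has_field_derivative h (x0 + x) / 2) (at x)" for x
    unfolding h_def[abs_def] by (auto intro!: derivative_eq_intros)
  have k2: "((\<lambda>x. h (x0 + x) / 2) has_field_derivative h x0 / 4) (at 0)"
    unfolding h_def[abs_def] by (auto intro!: derivative_eq_intros)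
  have \<Gamma>eq: "pair_vec (g1 x) (h (x0 + x)) = \<Gamma> (\<delta>, x0 + x)" for x
    by (simp add: \<Gamma>_def g1_def)
  have "pair_vec (g1 0) (h (x0 + 0)) \<in> S" unfolding \<Gamma>eq using inS[OF x0(1)] by simp
  from levi_form_along_holomorphic_curve[OF S(1) f(1) this g1 g2 k1 k2]
  obtain A1 A2 where A: "has_second_derivative (\<lambda>t. f (\<Gamma> (\<delta>, x0 + of_real t))) A1 0"
      "has_second_derivative (\<lambda>t. f (\<Gamma> (\<delta>, x0 + of_real t * \<i>))) A2 0"
      "A1 + A2 = 4 * Re (levi_form f (\<Gamma> (\<delta>, x0)) (pair_vec (g1' 0) (h (x0 + 0) / 2)))"
    unfolding \<Gamma>eq by auto
  have "pair_vec (g1' 0) (h (x0 + 0) / 2) \<noteq> 0"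
    using h0[of "x0 + 0"] by (auto simp: vec_eq_iff forall_2)
  then have Apos: "A1 + A2 > 0" using A(3) f(2)[OF inS[OF x0(1)]] by simp
  have lin: "((\<lambda>t. y + t) has_real_derivative 1) (at t)" for y t :: real
    by (rule DERIV_cong[OF DERIV_add[OF DERIV_const DERIV_ident]]) simp
  have N1: "has_second_derivative (\<lambda>t. N (x0 + of_real t)) (m * (- (k\<^sup>2 * h1 x0) + 2 * e)) 0"
  proof (rule has_second_derivativeI[OF open_UNIV UNIV_I])
    show "((\<lambda>t. N (x0 + of_real t)) has_real_derivative
        m * (exp (- (\<eta> * \<mu>) * Im x0) * - (sin (k * (s0 + (Re x0 + t))) * k) + e * (2 * (Re x0 + t)))) (at t)" for t
      unfolding N_def h1_def cmod_power2
      by (auto intro!: derivative_eq_intros simp: algebra_simps)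
    show "((\<lambda>t. m * (exp (- (\<eta> * \<mu>) * Im x0) * - (sin (k * (s0 + (Re x0 + t))) * k) + e * (2 * (Re x0 + t))))
        has_real_derivative m * (- (k\<^sup>2 * h1 x0) + 2 * e)) (at 0)"
      unfolding h1_def
      by (auto intro!: derivative_eq_intros simp: algebra_simps power2_eq_square)
  qed
  have N2: "has_second_derivative (\<lambda>t. N (x0 + of_real t * \<i>)) (m * ((\<eta> * \<mu>)\<^sup>2 * h1 x0 + 2 * e)) 0"
  proof (rule has_second_derivativeI[OF open_UNIV UNIV_I])
    show "((\<lambda>t. N (x0 + of_real t * \<i>)) has_real_derivative
        m * (- (\<eta> * \<mu>) * exp (- (\<eta> * \<mu>) * (Im x0 + t)) * cos (k * (s0 + Re x0)) + e * (2 * (Im x0 + t)))) (at t)" for t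
      unfolding N_def h1_def cmod_power2
      by (auto intro!: derivative_eq_intros simp: algebra_simps)
    show "((\<lambda>t. m * (- (\<eta> * \<mu>) * exp (- (\<eta> * \<mu>) * (Im x0 + t)) * cos (k * (s0 + Re x0)) + e * (2 * (Im x0 + t))))
        has_real_derivative m * ((\<eta> * \<mu>)\<^sup>2 * h1 x0 + 2 * e)) (at 0)"
      unfolding h1_def
      by (auto intro!: derivative_eq_intros simp: algebra_simps power2_eq_square)
  qed
  have max: "\<forall>\<^sub>F t in nhds 0. J (x0 + of_real t * u) \<le> J (x0 + of_real 0 * u)" for u :: complex
  proof -
    have "open ((\<lambda>t. x0 + of_real t * u) -` ball 0 r)"
      by (intro open_vimage continuous_intros) simp
    then have "\<forall>\<^sub>F t in nhds 0. t \<in> (\<lambda>t. x0 + of_real t * u) -` ball 0 r"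
      by (rule eventually_nhds_in_open) (use x0r in simp)
    then show ?thesis
    proof eventually_elim
      case (elim t)
      then have "x0 + of_real t * u \<in> B" by (simp add: B_def)
      then show ?case using x0(2) by simp
    qed
  qed
  have "has_second_derivative (\<lambda>t. J (x0 + of_real t * 1)) (1 / \<delta> powr \<eta> * A1 - m * (- (k\<^sup>2 * h1 x0) + 2 * e)) 0"
    using has_second_derivative_diff[OF has_second_derivative_cmult[OF A(1), of "1 / \<delta> powr \<eta>"] N1] by (simp add: J_def)
  then have 1: "1 / \<delta> powr \<eta> * A1 \<le> m * (- (k\<^sup>2 * h1 x0) + 2 * e)"
    using has_second_derivative_local_max max[of 1] by force
  have "has_second_derivative (\<lambda>t. J (x0 + of_real t * \<i>)) (1 / \<delta> powr \<eta> * A2 - m * ((\<eta> * \<mu>)\<^sup>2 * h1 x0 + 2 * e)) 0"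
    using has_second_derivative_diff[OF has_second_derivative_cmult[OF A(2), of "1 / \<delta> powr \<eta>"] N2] by (simp add: J_def)
  then have 2: "1 / \<delta> powr \<eta> * A2 \<le> m * ((\<eta> * \<mu>)\<^sup>2 * h1 x0 + 2 * e)"
    using has_second_derivative_local_max max[of "\<i>"] by force
  \<comment> \<open>The second derivative tests in the directions \<open>1\<close> and
    \<open>\<i>\<close> bound a positive Laplacian by that of \<open>N\<close>, which is negative by
    the choice of \<open>e\<close>.\<close>
  have "0 < 1 / \<delta> powr \<eta> * (A1 + A2)" using Apos \<delta>(1) by simp
  also have "\<dots> \<le> m * (4 * e - (k\<^sup>2 - (\<eta> * \<mu>)\<^sup>2) * h1 x0)"
    using 1 2 by (simp add: algebra_simps add_divide_distrib)
  finally have "(k\<^sup>2 - (\<eta> * \<mu>)\<^sup>2) * h1 x0 < 4 * e" using m by (simp add: zero_less_mult_iff)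
  moreover have "(k\<^sup>2 - (\<eta> * \<mu>)\<^sup>2) * c \<le> (k\<^sup>2 - (\<eta> * \<mu>)\<^sup>2) * h1 x0"
    using c(2)[OF x0(1)] kdiff by simp
  moreover have "8 * e = (k\<^sup>2 - (\<eta> * \<mu>)\<^sup>2) * c" by (simp add: e_def)
  ultimately show False using e by linarith
qed

section \<open>Both bounds combined into the infimum\<close>

theorem theorem5p3:
  fixes \<beta> :: real and \<phi> :: "real \<Rightarrow> real"
  assumes "\<beta> > pi / 2"
    and "worm_profile \<beta> \<phi>"
  shows "steinness_index (worm_domain \<phi>) =
    (if \<beta> < pi then ereal (pi / (2 * (pi - \<beta>))) else \<infinity>)"
proof -
  have exponent: "ereal (pi / (2 * (pi - \<beta>))) \<le> ereal \<eta> \<and> \<beta> < pi"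
    if \<rho>: "defining_function (worm_domain \<phi>) V \<rho>" and "\<eta> > 1" "open U" "frontier (worm_domain \<phi>) \<subseteq> U" "U \<subseteq> V"
      "strictly_plurisubharmonic_on (- closure (worm_domain \<phi>) \<inter> U) (\<lambda>z. \<rho> z powr \<eta>)" for V \<rho> U \<eta>
  proof (rule ccontr)
    assume not: "\<not> (ereal (pi / (2 * (pi - \<beta>))) \<le> ereal \<eta> \<and> \<beta> < pi)"
    show False
    proof (cases "\<beta> < pi")
      case True
      with not have "\<eta> < pi / (2 * (pi - \<beta>))" by simp
      then have "\<eta> * (pi / 2 - (\<beta> - pi / 2)) < pi / 2" using True by (simp add: field_simps)
      then show False
        using worm_no_exponent[OF assms(2) that(1,3-6,2), of "\<beta> - pi / 2"] assms(1) True by simp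
    next
      case False
      \<comment> \<open>For \<open>\<beta> \<ge> pi\<close> the choice \<open>b = pi / 2\<close>
        makes \<open>\<mu> = 0\<close>, so every exponent is excluded and the infimum is over empty
        sets.\<close>
      then show False
        using worm_no_exponent[OF assms(2) that(1,3-6,2), of "pi / 2"] by simp
    qed
  qed
  show ?thesis
  proof (cases "\<beta> < pi")
    case True
    have "ereal (pi / (2 * (pi - \<beta>))) \<le> steinness_index (worm_domain \<phi>)"
      unfolding steinness_index_def steinness_exponent_def
      by (rule Inf_greatest, clarify, rule Inf_greatest) (use exponent in blast)
    moreover have "steinness_index (worm_domain \<phi>) \<le> ereal (pi / (2 * (pi - \<beta>)))"
    \<comment> \<open>The upper bound is available only for exponents strictly above the threshold,
      so the threshold is approached from above.\<close>
    proof (rule ereal_le_epsilon2)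
      fix e :: real assume "0 < e"
      then show "steinness_index (worm_domain \<phi>) \<le> ereal (pi / (2 * (pi - \<beta>))) + ereal e"
        using steinness_index_worm_le[OF assms(1) True assms(2), of "pi / (2 * (pi - \<beta>)) + e"] by simp
    qed
    ultimately show ?thesis using True by (simp add: antisym)
  next
    case False
    have "\<infinity> \<le> steinness_index (worm_domain \<phi>)"
      unfolding steinness_index_def steinness_exponent_def
      by (rule Inf_greatest, clarify, rule Inf_greatest) (use exponent False in blast)
    then show ?thesis using False by simp
  qed
qed

end
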